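(* Let $\mathbf{X}\in\mathbb{R}^{n\times p}$ be a fixed matrix of full column rank $p<n$, let $\mathbf{y}\sim N(\mathbf{X}\boldsymbol{\beta}_0,\sigma^2\mathbf{I}_n)$ with $\boldsymbol{\beta}_0\in\mathbb{R}^p$ and $\sigma>0$, let $k>p$, and let $\mathbf{S}$ be a $k\times n$ Gaussian sketching matrix independent of $\mathbf{y}$. Then $\dfrac{SSR_s}{SSR_F/k}$ conditionally on $SSR_F$ has the $\chi^2_{k-p}$ distribution, $SSR_F/\sigma^2\sim\chi^2_{n-p}$, $$E(SSR_s)=\sigma^2\,\frac{(k-p)(n-p)}{k},$$ so that $SSR_s\times\frac{k}{(n-p)(k-p)}$ is an unbiased estimator of $\sigma^2$, and $SSR_s/\sigma^2$ has density $$h(u)=\frac{u^{(n+k-2p)/4-1}\,K_{(k-n)/2}(\sqrt{u})}{\Gamma\left(\frac{k-p}{2}\right)\Gamma\left(\frac{n-p}{2}\right)2^{(n-p)/2+(k-p)/2-1}},\qquad u>0.$$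
   Context: A Gaussian sketching matrix $\mathbf{S}$ of size $k\times n$ has independent entries $\mathbf{S}_{ij}\sim N(0,1/k)$. The sketched data are $\mathbf{X}_s=\mathbf{S}\mathbf{X}$ and $\mathbf{y}_s=\mathbf{S}\mathbf{y}$. The residual sums of squares are $SSR_F=\mathbf{y}^{\mathsf T}\{\mathbf{I}-\mathbf{X}(\mathbf{X}^{\mathsf T}\mathbf{X})^{-1}\mathbf{X}^{\mathsf T}\}\mathbf{y}$ and $SSR_s=\mathbf{y}_s^{\mathsf T}\{\mathbf{I}-\mathbf{X}_s(\mathbf{X}_s^{\mathsf T}\mathbf{X}_s)^{-1}\mathbf{X}_s^{\mathsf T}\}\mathbf{y}_s$. $K_\nu$ is the modified Bessel function of the second kind.
   Formalization: The density claim is corrected: h is proved to be the density of k·SSR_s/σ², not of SSR_s/σ². As printed the claim is false, since h has mean (k−p)(n−p) whereas E(SSR_s/σ²) = (k−p)(n−p)/k. *)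

theory Defs
  imports "HOL-Probability.Probability"
begin

text \<open>The density of \<open>N(\<mu>, \<Sigma>)\<close>, for a positive definite covariance matrix \<open>\<Sigma>\<close>.\<close>

definition mvn_density :: "real ^ 'n \<Rightarrow> real ^ 'n ^ 'n \<Rightarrow> real ^ 'n \<Rightarrow> real" where
  "mvn_density \<mu> \<Sigma> x =
     exp (- ((x - \<mu>) \<bullet> (matrix_inv \<Sigma> *v (x - \<mu>))) / 2)
       / sqrt ((2 * pi) ^ CARD('n) * det \<Sigma>)"

definition chi_square_density :: "real \<Rightarrow> real \<Rightarrow> real" where
  "chi_square_density \<nu> x =
     (if x > 0 then x powr (\<nu> / 2 - 1) * exp (- x / 2) / (2 powr (\<nu> / 2) * Gamma (\<nu> / 2)) else 0)"

definition chi_square :: "real \<Rightarrow> real measure" where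
  "chi_square \<nu> = density lborel (\<lambda>x. ennreal (chi_square_density \<nu> x))"

text \<open>The modified Bessel function of the second kind, of real order \<open>\<nu>\<close> and at \<open>x > 0\<close> only,
  given by Schlaefli's integral (DLMF 10.32.9).\<close>

definition bessel_K :: "real \<Rightarrow> real \<Rightarrow> real" where
  "bessel_K \<nu> x = (LBINT t:{0<..}. exp (- x * cosh t) * cosh (\<nu> * t))"

text \<open>\<open>normal_density\<close> takes the standard deviation as its parameter, here \<open>1 / sqrt k\<close>.\<close>

definition gaussian_sketch :: "'a measure \<Rightarrow> ('a \<Rightarrow> real ^ 'n ^ 'k) \<Rightarrow> bool" where
  "gaussian_sketch M S \<longleftrightarrow>
     prob_space.indep_vars M (\<lambda>_. borel) (\<lambda>(i, j) \<omega>. S \<omega> $ i $ j) UNIV \<and>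
     (\<forall>i j. distributed M lborel (\<lambda>\<omega>. S \<omega> $ i $ j)
              (\<lambda>x. ennreal (normal_density 0 (1 / sqrt (real CARD('k))) x)))"

text \<open>If \<open>X\<^sup>T X\<close> is singular, \<open>matrix_inv\<close> yields an unspecified constant matrix.\<close>

definition SSR :: "real ^ 'p ^ 'm \<Rightarrow> real ^ 'm \<Rightarrow> real" where
  "SSR X y = y \<bullet> ((mat 1 - X ** matrix_inv (transpose X ** X) ** transpose X) *v y)"

text \<open>The probability kernel \<open>\<kappa>\<close> is a regular conditional distribution of \<open>Y\<close> given \<open>X\<close>:
  \<open>P(Y \<in> A | \<sigma>(X)) = \<kappa>(X, A)\<close> almost surely, for every Borel set \<open>A\<close>.\<close>

definition has_cond_distribution ::
    "'a measure \<Rightarrow> ('a \<Rightarrow> real) \<Rightarrow> ('a \<Rightarrow> real) \<Rightarrow> (real \<Rightarrow> real measure) \<Rightarrow> bool" where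
  "has_cond_distribution M Y X \<kappa> \<longleftrightarrow>
     Y \<in> borel_measurable M \<and> X \<in> borel_measurable M \<and> \<kappa> \<in> borel \<rightarrow>\<^sub>M prob_algebra borel \<and>
     (\<forall>A \<in> sets borel. AE \<omega> in M.
        real_cond_exp M (vimage_algebra (space M) X borel) (\<lambda>\<omega>. indicator A (Y \<omega>)) \<omega>
          = measure (\<kappa> (X \<omega>)) A)"

end

(* Write SSR_F = |r|^2 with r the residual of y, and fix y. Since r is orthogonal to the columns of X,
   the Gaussian vector S r / |r| is independent of S X, and S X has full rank almost surely, so
   SSR_s / (SSR_F / k) is the squared length of the projection of a standard Gaussian vector in R^k
   to the orthogonal complement of a subspace of dimension p. Its law chi^2_(k-p) does not depend on
   y; hence SSR_s / (sigma^2 / k) is a product of independent chi^2_(k-p) and chi^2_(n-p)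
   variables, whose density is Schlaefli's integral for K. *)

theory Submission
  imports Defs "HOL-Computational_Algebra.Polynomial"
begin

section \<open>Changes of variables\<close>

text \<open>The independence behind the projection argument is never stated for events. It enters as
  a resampling identity for \<open>gauss s\<close> (\<open>nn_integral_gauss_swap\<close>):
  replacing the component of a Gaussian in the range of an isometric embedding by a fresh Gaussian
  changes no nonnegative integral. Because it is built from shears, its proof takes only Tonelli and
  translation invariance, and no orthogonal change of variables in high dimension. It is used twice:
  with a single direction u, which splits off one chi-square degree of freedom at a time, and with
  the matrices g u^T, which resamples S u. Two exceptional sets need care. On singular Gram matrices
  \<open>SSR\<close> contains an unspecified inverse, so full rank is shown outside a Lebesgue null
  set, while measurability of \<open>SSR\<close> is shown on all matrices. Where SSR_F vanishes the
  quotient is 0 by convention; this has probability 0.\<close>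

lemma emeasure_distr_nn_integral:
  assumes [measurable]: "f \<in> M \<rightarrow>\<^sub>M N" "A \<in> sets N"
  shows "emeasure (distr M N f) A = (\<integral>\<^sup>+x. indicator A (f x) \<partial>M)"
  by (subst nn_integral_indicator[symmetric], simp, subst nn_integral_distr) (simp_all del: nn_integral_indicator)

text \<open>A bridge: the substitution theorem speaks of \<open>absolutely_integrable_on\<close>,
  densities speak of \<open>nn_integral\<close>. For a nonnegative integrand both amount to having
  the finite integral b.\<close>

lemma absolutely_integrable_nonneg_iff_nn_integral:
  fixes k :: "real \<Rightarrow> real"
  assumes [measurable]: "k \<in> borel_measurable borel" "A \<in> sets borel" and nn: "\<And>x. k x \<ge> 0"
  shows "k absolutely_integrable_on A \<and> integral A k = b
    \<longleftrightarrow> b \<ge> 0 \<and> (\<integral>\<^sup>+x. ennreal (k x) * indicator A x \<partial>lborel) = ennreal b"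
proof (intro iffI conjI; elim conjE)
  assume k: "k absolutely_integrable_on A" "integral A k = b"
  then have "(k has_integral b) A"
    by (auto simp: absolutely_integrable_on_def)
  then show "b \<ge> 0" "(\<integral>\<^sup>+x. ennreal (k x) * indicator A x \<partial>lborel) = ennreal b"
    using nn by (auto intro: has_integral_nonneg nn_integral_has_integral_lebesgue')
next
  assume b: "b \<ge> 0" "(\<integral>\<^sup>+x. ennreal (k x) * indicator A x \<partial>lborel) = ennreal b"
  have "(\<integral>\<^sup>+x. ennreal (k x * indicator A x) \<partial>lborel) = ennreal b"
    using b(2) by (simp add: nn ennreal_mult ennreal_indicator)
  then have "((\<lambda>x. k x * indicator A x) has_integral b) UNIV"
    using b(1) nn by (intro nn_integral_has_integral) auto
  moreover have "(\<lambda>x. k x * indicator A x) = (\<lambda>x. if x \<in> A then k x else 0)"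
    by (auto simp: fun_eq_iff)
  ultimately have I: "(k has_integral b) A"
    by (simp add: has_integral_restrict_UNIV)
  then show "integral A k = b" by (rule integral_unique)
  show "k absolutely_integrable_on A"
    using I nn by (intro nonnegative_absolutely_integrable_1) auto
qed

text \<open>The substitution theorem gives, for each finite b, that one side equals b iff the other
  does. Hence the sides agree when one is finite, and otherwise both are infinite.\<close>

lemma nn_integral_change_of_variables:
  fixes g g' h :: "real \<Rightarrow> real"
  assumes [measurable]: "S \<in> sets borel" "g ` S \<in> sets borel" "g \<in> borel_measurable borel"
      "g' \<in> borel_measurable borel" "h \<in> borel_measurable borel"
    and der: "\<And>x. x \<in> S \<Longrightarrow> (g has_field_derivative g' x) (at x within S)"
    and inj: "inj_on g S" and nn: "\<And>x. h x \<ge> 0"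
  shows "(\<integral>\<^sup>+x. ennreal (h x) * indicator (g ` S) x \<partial>lborel)
    = (\<integral>\<^sup>+x. ennreal (\<bar>g' x\<bar> * h (g x)) * indicator S x \<partial>lborel)" (is "?L = ?R")
proof -
  have iff: "?R = ennreal b \<longleftrightarrow> ?L = ennreal b" if "b \<ge> 0" for b
  proof -
    have "?R = ennreal b \<longleftrightarrow> (\<lambda>x. \<bar>g' x\<bar> * h (g x)) absolutely_integrable_on S
        \<and> integral S (\<lambda>x. \<bar>g' x\<bar> * h (g x)) = b"
      using that nn by (subst absolutely_integrable_nonneg_iff_nn_integral) auto
    also have "\<dots> \<longleftrightarrow> h absolutely_integrable_on (g ` S) \<and> integral (g ` S) h = b"
      using der inj by (intro has_absolute_integral_change_of_variables_1') auto
    also have "\<dots> \<longleftrightarrow> ?L = ennreal b"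
      using that nn by (subst absolutely_integrable_nonneg_iff_nn_integral) auto
    finally show ?thesis .
  qed
  show ?thesis
  proof (cases "?L")
    case (real r) then show ?thesis using iff[of r] by auto
  next
    case top
    then show ?thesis using iff by (cases "?R") auto
  qed
qed

text \<open>Serves twice: squaring is injective only on the positive half-line, and folding exp (c
  t) at 0 produces the cosh of the Bessel integral.\<close>

lemma nn_integral_real_fold:
  fixes f :: "real \<Rightarrow> ennreal"
  assumes [measurable]: "f \<in> borel_measurable borel"
  shows "(\<integral>\<^sup>+x. f x \<partial>lborel) = (\<integral>\<^sup>+x. (f x + f (- x)) * indicator {0<..} x \<partial>lborel)"
proof -
  have "(\<integral>\<^sup>+x. f x \<partial>lborel) = (\<integral>\<^sup>+x. f x * indicator {0<..} x + f x * indicator {..<0} x \<partial>lborel)"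
    using AE_lborel_singleton[of "0::real"] by (intro nn_integral_cong_AE) (auto simp: indicator_def)
  also have "\<dots> = (\<integral>\<^sup>+x. f x * indicator {0<..} x \<partial>lborel) + (\<integral>\<^sup>+x. f x * indicator {..<0} x \<partial>lborel)"
    by (subst nn_integral_add) auto
  also have "(\<integral>\<^sup>+x. f x * indicator {..<0} x \<partial>lborel) = (\<integral>\<^sup>+x. f (- x) * indicator {0<..} x \<partial>lborel)"
    by (subst nn_integral_real_affine[where c = "-1" and t = 0])
      (auto intro!: nn_integral_cong split: split_indicator)
  finally show ?thesis
    by (simp add: distrib_right nn_integral_add)
qed

section \<open>Chi-square distributions\<close>

lemma chi_square_density_nonneg: "\<nu> > 0 \<Longrightarrow> chi_square_density \<nu> x \<ge> 0"
  by (simp add: chi_square_density_def Gamma_real_nonneg)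

lemma borel_measurable_chi_square_density [measurable]: "chi_square_density \<nu> \<in> borel_measurable borel"
  unfolding chi_square_density_def[abs_def] by measurable

lemma sets_chi_square [simp, measurable_cong]: "sets (chi_square \<nu>) = sets borel"
  by (simp add: chi_square_def)

lemma space_chi_square [simp]: "space (chi_square \<nu>) = UNIV"
  by (simp add: chi_square_def)

text \<open>Euler's integral for \<open>Gamma a\<close> after t = u / 2; every chi-square constant
  below comes from it.\<close>

lemma nn_integral_powr_exp_half:
  assumes "a > 0"
  shows "(\<integral>\<^sup>+u. ennreal (u powr (a - 1) * exp (- u / 2)) * indicator {0<..} u \<partial>lborel)
    = ennreal (2 powr a * Gamma a)"
proof -
  define f where "f t = ennreal (t powr (a - 1) / exp t) * indicator {0<..} t" for t :: real
  have [measurable]: "f \<in> borel_measurable borel" unfolding f_def[abs_def] by measurable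
  have "ennreal (Gamma a) = (\<integral>\<^sup>+t. ennreal (t powr (a - 1) / exp t) * indicator {0..} t \<partial>lborel)"
    using Gamma_integral_real[OF assms] by (intro nn_integral_has_integral_lebesgue'[symmetric]) auto
  also have "\<dots> = (\<integral>\<^sup>+t. f t \<partial>lborel)"
    using AE_lborel_singleton[of "0::real"] by (intro nn_integral_cong_AE) (auto simp: f_def indicator_def)
  also have "\<dots> = ennreal (1 / 2) * (\<integral>\<^sup>+u. f (0 + 1 / 2 * u) \<partial>lborel)"
    by (subst nn_integral_real_affine[where c = "1/2" and t = 0]) simp_all
  also have "(\<lambda>u. f (0 + 1 / 2 * u)) = (\<lambda>u. ennreal ((1/2) powr (a - 1)) * (ennreal (u powr (a - 1) * exp (- u / 2)) * indicator {0<..} u))"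
    by (auto simp: f_def fun_eq_iff indicator_def powr_mult exp_minus field_simps ennreal_mult[symmetric] powr_divide)
  also have "ennreal (1 / 2) * (\<integral>\<^sup>+u. \<dots> u \<partial>lborel) = ennreal ((1/2) powr a)
      * (\<integral>\<^sup>+u. ennreal (u powr (a - 1) * exp (- u / 2)) * indicator {0<..} u \<partial>lborel)"
  proof -
    have "1 / 2 * (1 / 2) powr (a - 1) = (1 / 2) powr a"
      by (simp add: powr_diff)
    then have "ennreal (1 / 2) * ennreal ((1 / 2) powr (a - 1)) = ennreal ((1/2) powr a)"
      by (metis ennreal_mult half_gt_zero_iff less_imp_le powr_ge_zero zero_less_one)
    then show ?thesis
      by (subst nn_integral_cmult) (simp_all add: mult.assoc[symmetric])
  qed
  finally have I: "ennreal (Gamma a) = ennreal ((1/2) powr a)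
      * (\<integral>\<^sup>+u. ennreal (u powr (a - 1) * exp (- u / 2)) * indicator {0<..} u \<partial>lborel)" .
  have "2 powr a * (1/2) powr a = (1::real)"
    by (simp flip: powr_mult)
  then have "ennreal (2 powr a) * ennreal ((1/2) powr a) = 1"
    by (metis ennreal_1 ennreal_mult powr_ge_zero)
  moreover have "ennreal (2 powr a * Gamma a) = ennreal (2 powr a) * ennreal (Gamma a)"
    using assms by (intro ennreal_mult) (simp_all add: Gamma_real_nonneg)
  ultimately show ?thesis
    unfolding I by (simp only: mult.assoc[symmetric] mult_1_left)
qed

text \<open>The factor u^r only shifts the exponent, so the integral is again of Gamma type. The
  case r = 0 gives total mass 1 and r = 1 gives the mean.\<close>

lemma nn_integral_chi_square_density_powr:
  assumes "\<nu> > 0" "r \<ge> 0"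
  shows "(\<integral>\<^sup>+u. ennreal (u powr r * chi_square_density \<nu> u) \<partial>lborel)
    = ennreal (2 powr r * Gamma (\<nu> / 2 + r) / Gamma (\<nu> / 2))"
proof -
  define c where "c = 1 / (2 powr (\<nu> / 2) * Gamma (\<nu> / 2))"
  have G: "Gamma (\<nu> / 2) > 0" "Gamma (\<nu> / 2 + r) > 0" using assms by (auto intro!: Gamma_real_pos)
  have c: "c \<ge> 0" using G by (simp add: c_def)
  have "(\<integral>\<^sup>+u. ennreal (u powr r * chi_square_density \<nu> u) \<partial>lborel)
    = (\<integral>\<^sup>+u. ennreal c * (ennreal (u powr (\<nu> / 2 + r - 1) * exp (- u / 2)) * indicator {0<..} u) \<partial>lborel)"
  proof (intro nn_integral_cong)
    fix u :: real
    show "ennreal (u powr r * chi_square_density \<nu> u)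
      = ennreal c * (ennreal (u powr (\<nu> / 2 + r - 1) * exp (- u / 2)) * indicator {0<..} u)"
    proof (cases "u > 0")
      case True
      then have "u powr r * chi_square_density \<nu> u = c * (u powr (\<nu> / 2 + r - 1) * exp (- u / 2))"
        by (simp add: chi_square_density_def c_def powr_add powr_diff mult_ac)
      then show ?thesis using True c by (simp add: ennreal_mult[symmetric])
    qed (simp add: chi_square_density_def)
  qed
  also have "\<dots> = ennreal c * ennreal (2 powr (\<nu> / 2 + r) * Gamma (\<nu> / 2 + r))"
    using assms nn_integral_powr_exp_half[of "\<nu> / 2 + r"] by (subst nn_integral_cmult) simp_all
  also have "\<dots> = ennreal (2 powr r * Gamma (\<nu> / 2 + r) / Gamma (\<nu> / 2))"
    using G c by (simp add: c_def ennreal_mult[symmetric] powr_add)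
  finally show ?thesis .
qed

lemma prob_space_chi_square:
  assumes "\<nu> > 0"
  shows "prob_space (chi_square \<nu>)"
proof
  \<comment> \<open>\<open>u powr 0\<close> is 1 except at u = 0, where it is 0; the density
    vanishes there as well.\<close>
  have "(\<integral>\<^sup>+u. ennreal (chi_square_density \<nu> u) \<partial>lborel) = (\<integral>\<^sup>+u. ennreal (u powr 0 * chi_square_density \<nu> u) \<partial>lborel)"
    by (intro nn_integral_cong) (simp add: chi_square_density_def)
  also have "\<dots> = 1"
    using nn_integral_chi_square_density_powr[OF assms, of 0] Gamma_real_pos[of "\<nu>/2"] assms
    by (simp add: less_imp_neq[symmetric])
  finally show "emeasure (chi_square \<nu>) (space (chi_square \<nu>)) = 1"
    by (simp add: chi_square_def emeasure_density)
qed

lemma nn_integral_chi_square_ident: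
  assumes "\<nu> > 0"
  shows "(\<integral>\<^sup>+u. ennreal u \<partial>chi_square \<nu>) = ennreal \<nu>"
proof -
  have "ennreal (chi_square_density \<nu> u) * ennreal u = ennreal (u powr 1 * chi_square_density \<nu> u)" for u
    using chi_square_density_nonneg[OF assms, of u]
    by (cases "u > 0") (simp_all add: chi_square_density_def[of _ u] ennreal_mult[symmetric] mult.commute)
  then have "(\<integral>\<^sup>+u. ennreal u \<partial>chi_square \<nu>) = (\<integral>\<^sup>+u. ennreal (u powr 1 * chi_square_density \<nu> u) \<partial>lborel)"
    unfolding chi_square_def by (subst nn_integral_density) simp_all
  also have "\<dots> = ennreal \<nu>"
  proof -
    have "\<nu> / 2 \<notin> \<int>\<^sub>\<le>\<^sub>0" using assms nonpos_Ints_nonpos[of "\<nu> / 2"] by auto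
    then have "Gamma (\<nu> / 2 + 1) = \<nu> / 2 * Gamma (\<nu> / 2)" by (rule Gamma_plus1)
    moreover have "Gamma (\<nu> / 2) > 0" using assms by (intro Gamma_real_pos) simp
    ultimately have "2 powr 1 * Gamma (\<nu> / 2 + 1) / Gamma (\<nu> / 2) = \<nu>"
      by (simp add: field_simps)
    then show ?thesis
      unfolding nn_integral_chi_square_density_powr[OF assms zero_le_one] by simp
  qed
  finally show ?thesis .
qed

text \<open>Substituting y = x t in the convolution integral over 0 < y < x leaves a Beta integral
  in t, and \<open>Beta\<close> as a quotient of Gamma values supplies the normalising constant for
  a + b.\<close>

lemma chi_square_convolution:
  assumes a: "a > 0" and b: "b > 0"
  shows "chi_square a \<star> chi_square b = chi_square (a + b)"
proof -
  have G: "Gamma (a / 2) > 0" "Gamma (b / 2) > 0" "Gamma ((a + b) / 2) > 0"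
    using a b by (auto intro!: Gamma_real_pos)
  define c where "c = 1 / (2 powr (a / 2) * Gamma (a / 2)) * (1 / (2 powr (b / 2) * Gamma (b / 2)))"
  have c: "c \<ge> 0" using G a b by (simp add: c_def)
  have fin: "finite_measure (density lborel (\<lambda>x. ennreal (chi_square_density \<nu> x)))" if "\<nu> > 0" for \<nu>
    using prob_space_chi_square[OF that] unfolding chi_square_def by (rule prob_space.finite_measure)
  have "(\<integral>\<^sup>+y. ennreal (chi_square_density a (x - y)) * ennreal (chi_square_density b y) \<partial>lborel)
      = ennreal (chi_square_density (a + b) x)" for x
  proof (cases "x > 0")
    case False
    then have *: "ennreal (chi_square_density a (x - y)) * ennreal (chi_square_density b y) = 0" for y
      by (auto simp: chi_square_density_def)
    show ?thesis unfolding * using False by (simp add: chi_square_density_def)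
  next
    case x: True
    \<comment> \<open>All factors free of t. The two densities contribute x to the power (a/2 - 1) +
      (b/2 - 1) = (a+b)/2 - 2; the missing power of x is the Jacobian of y = x t.\<close>
    define d where "d = c * exp (- x / 2) * x powr ((a + b) / 2 - 2)"
    define f where "f y = ennreal (chi_square_density a (x - y)) * ennreal (chi_square_density b y)" for y
    have [measurable]: "f \<in> borel_measurable borel" unfolding f_def[abs_def] by measurable
    have d: "d \<ge> 0" using c by (simp add: d_def)
    have f: "f (0 + x * t) = ennreal d * (ennreal (t powr (b / 2 - 1) * (1 - t) powr (a / 2 - 1)) * indicator {0<..<1} t)" for t
    proof (cases "0 < t \<and> t < 1")
      case False
      then show ?thesis using x
        by (auto simp: f_def chi_square_density_def indicator_def zero_less_mult_iff mult_less_cancel_left1)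
    next
      case t: True
      have eq: "x - x * t = x * (1 - t)" by (simp add: algebra_simps)
      have pos: "x * (1 - t) > 0" "x * t > 0" using t x by auto
      have e: "exp (- (x * (1 - t)) / 2) * exp (- (x * t) / 2) = exp (- x / 2)"
        by (simp add: exp_add[symmetric] field_simps)
      have p: "x powr (a / 2 - 1) * x powr (b / 2 - 1) = x powr ((a + b) / 2 - 2)"
        by (simp add: powr_add[symmetric] add_divide_distrib)
      have "chi_square_density a (x - x * t) * chi_square_density b (x * t)
        = c * (exp (- (x * (1 - t)) / 2) * exp (- (x * t) / 2)) * (x powr (a / 2 - 1) * x powr (b / 2 - 1))
           * (t powr (b / 2 - 1) * (1 - t) powr (a / 2 - 1))"
        using pos t x by (simp add: eq chi_square_density_def powr_mult c_def)
      also have "\<dots> = d * (t powr (b / 2 - 1) * (1 - t) powr (a / 2 - 1))"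
        unfolding e p d_def ..
      finally show ?thesis
        using t a b d by (simp add: f_def ennreal_mult[symmetric] chi_square_density_nonneg)
    qed
    have "(\<integral>\<^sup>+y. f y \<partial>lborel) = ennreal x * (\<integral>\<^sup>+t. f (0 + x * t) \<partial>lborel)"
      using x by (subst nn_integral_real_affine[where c = x and t = 0]) simp_all
    also have "\<dots> = ennreal x * (ennreal d * (\<integral>\<^sup>+t. ennreal (t powr (b / 2 - 1) * (1 - t) powr (a / 2 - 1)) * indicator {0<..<1} t \<partial>lborel))"
      unfolding f by (subst nn_integral_cmult) simp_all
    also have "(\<integral>\<^sup>+t. ennreal (t powr (b / 2 - 1) * (1 - t) powr (a / 2 - 1)) * indicator {0<..<1} t \<partial>lborel)
       = (\<integral>\<^sup>+t. ennreal (t powr (b / 2 - 1) * (1 - t) powr (a / 2 - 1)) * indicator {0..1} t \<partial>lborel)"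
      using AE_lborel_singleton[of "0::real"] AE_lborel_singleton[of "1::real"]
      by (intro nn_integral_cong_AE) (auto simp: indicator_def)
    also have "\<dots> = ennreal (Beta (b / 2) (a / 2))"
      using a b by (intro nn_integral_has_integral_lebesgue' has_integral_Beta_real) auto
    also have "ennreal x * (ennreal d * ennreal (Beta (b / 2) (a / 2))) = ennreal (x * (d * Beta (b / 2) (a / 2)))"
      using x d G a b by (subst ennreal_mult, simp, simp add: Beta_def, subst ennreal_mult) (auto simp: Beta_def add.commute add_divide_distrib)
    also have "x * (d * Beta (b / 2) (a / 2)) = chi_square_density (a + b) x"
    proof -
      have "x * x powr ((a + b) / 2 - 2) = x powr ((a + b) / 2 - 1)"
        using x by (simp add: powr_mult_base)
      moreover have "c * Beta (b / 2) (a / 2) = 1 / (2 powr ((a + b) / 2) * Gamma ((a + b) / 2))"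
        using G(1)[THEN less_imp_neq] G(2)[THEN less_imp_neq] a b
        by (simp add: c_def Beta_def powr_add add_divide_distrib add.commute)
      moreover have "x * (d * Beta (b / 2) (a / 2)) = c * Beta (b / 2) (a / 2) * exp (- x / 2) * (x * x powr ((a + b) / 2 - 2))"
        unfolding d_def by (simp only: mult_ac)
      ultimately show ?thesis
        using x by (simp add: chi_square_density_def)
    qed
    finally show ?thesis unfolding f_def .
  qed
  then show ?thesis
    unfolding chi_square_def by (subst convolution_density[OF _ _ fin[OF a] fin[OF b]]) simp_all
qed

lemma distr_normal_square:
  assumes s: "s > 0"
  shows "distr (density lborel (\<lambda>x. ennreal (normal_density 0 s x))) borel (\<lambda>x. x\<^sup>2 / s\<^sup>2) = chi_square 1"
proof (rule measure_eqI)
  fix A assume "A \<in> sets (distr (density lborel (\<lambda>x. ennreal (normal_density 0 s x))) borel (\<lambda>x. x\<^sup>2 / s\<^sup>2))"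
  then have A [measurable]: "A \<in> sets borel" by simp
  define f where "f x = ennreal (normal_density 0 s x) * indicator A (x\<^sup>2 / s\<^sup>2)" for x
  have [measurable]: "f \<in> borel_measurable borel" unfolding f_def[abs_def] by measurable
  have sym: "f (- x) = f x" for x by (simp add: f_def normal_density_def)
  have "emeasure (distr (density lborel (\<lambda>x. ennreal (normal_density 0 s x))) borel (\<lambda>x. x\<^sup>2 / s\<^sup>2)) A
    = (\<integral>\<^sup>+x. f x \<partial>lborel)"
    unfolding f_def by (subst nn_integral_indicator[symmetric], simp, subst nn_integral_distr)
      (simp_all add: nn_integral_density del: nn_integral_indicator)
  also have "\<dots> = (\<integral>\<^sup>+x. 2 * (f x * indicator {0<..} x) \<partial>lborel)"
    by (subst nn_integral_real_fold) (simp_all add: sym mult_2[symmetric] mult.assoc)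
  \<comment> \<open>The factor 2 from folding the two branches of the square root is the 2 in the
    derivative 2 x / s^2.\<close>
  also have "\<dots> = (\<integral>\<^sup>+x. ennreal (\<bar>2 * x / s\<^sup>2\<bar> * (chi_square_density 1 (x\<^sup>2 / s\<^sup>2) * indicator A (x\<^sup>2 / s\<^sup>2))) * indicator {0<..} x \<partial>lborel)"
  proof (intro nn_integral_cong)
    fix x :: real
    have "2 * normal_density 0 s x = \<bar>2 * x / s\<^sup>2\<bar> * chi_square_density 1 (x\<^sup>2 / s\<^sup>2)" if "x > 0"
    proof -
      have "(x\<^sup>2 / s\<^sup>2) powr (- (1/2)) = s / x"
        using that s by (simp add: powr_minus powr_half_sqrt real_sqrt_divide)
      then show ?thesis
        using that s
        by (simp add: normal_density_def chi_square_density_def Gamma_one_half_real powr_half_sqrt real_sqrt_mult field_simps power2_eq_square)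
    qed
    then show "2 * (f x * indicator {0<..} x) = ennreal (\<bar>2 * x / s\<^sup>2\<bar> * (chi_square_density 1 (x\<^sup>2 / s\<^sup>2) * indicator A (x\<^sup>2 / s\<^sup>2))) * indicator {0<..} x"
      by (auto simp: f_def indicator_def mult.assoc[symmetric] simp flip: ennreal_numeral ennreal_mult)
  qed
  also have "\<dots> = (\<integral>\<^sup>+u. ennreal (chi_square_density 1 u * indicator A u) * indicator ((\<lambda>x. x\<^sup>2 / s\<^sup>2) ` {0<..}) u \<partial>lborel)"
  proof (rule nn_integral_change_of_variables[symmetric])
    have "(\<lambda>x. x\<^sup>2 / s\<^sup>2) ` {0<..} = {0<..}"
    proof (intro equalityI subsetI)
      fix u :: real assume "u \<in> {0<..}"
      then show "u \<in> (\<lambda>x. x\<^sup>2 / s\<^sup>2) ` {0<..}"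
        using s by (intro image_eqI[of _ _ "s * sqrt u"]) (auto simp: power_mult_distrib)
    qed (use s in auto)
    then show "(\<lambda>x. x\<^sup>2 / s\<^sup>2) ` {0<..} \<in> sets borel" by simp
    show "((\<lambda>x. x\<^sup>2 / s\<^sup>2) has_field_derivative 2 * x / s\<^sup>2) (at x within {0<..})" for x
      using s by (auto intro!: derivative_eq_intros simp: field_simps)
    show "inj_on (\<lambda>x. x\<^sup>2 / s\<^sup>2) {0<..}"
      using s by (auto simp: inj_on_def)
    show "chi_square_density 1 u * indicator A u \<ge> 0" for u
      by (simp add: chi_square_density_nonneg)
  qed measurable
  also have "\<dots> = (\<integral>\<^sup>+u. ennreal (chi_square_density 1 u) * indicator A u \<partial>lborel)"
  proof (intro nn_integral_cong)
    fix u :: real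
    have "u \<in> (\<lambda>x. x\<^sup>2 / s\<^sup>2) ` {0<..}" if "u > 0"
      using s that by (intro image_eqI[of _ _ "s * sqrt u"]) (auto simp: power_mult_distrib)
    then show "ennreal (chi_square_density 1 u * indicator A u) * indicator ((\<lambda>x. x\<^sup>2 / s\<^sup>2) ` {0<..}) u
      = ennreal (chi_square_density 1 u) * indicator A u"
      by (auto simp: indicator_def chi_square_density_def)
  qed
  also have "\<dots> = emeasure (chi_square 1) A"
    by (simp add: chi_square_def emeasure_density)
  finally show "emeasure (distr (density lborel (\<lambda>x. ennreal (normal_density 0 s x))) borel (\<lambda>x. x\<^sup>2 / s\<^sup>2)) A
    = emeasure (chi_square 1) A" .
qed simp

section \<open>Products of independent chi-square variables and the Bessel function\<close>

lemma borel_measurable_cosh [measurable]: "(cosh :: real \<Rightarrow> real) \<in> borel_measurable borel"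
  unfolding cosh_field_def[abs_def] by measurable

lemma borel_measurable_bessel_K [measurable]: "bessel_K \<nu> \<in> borel_measurable borel"
  unfolding bessel_K_def[abs_def] set_lebesgue_integral_def by measurable

text \<open>Substituting \<open>v = \<surd>u e\<^sup>t\<close> in \<open>\<integral> f\<^sub>a(u / v) f\<^sub>b(v) dv / v\<close> gives Schlaefli's integral. The latter
  is finite for almost every \<open>u\<close> because the total mass is 1.\<close>

lemma distr_chi_square_mult:
  assumes a: "a > 0" and b: "b > 0"
  shows "distr (chi_square a \<Otimes>\<^sub>M chi_square b) borel (\<lambda>(q, v). q * v)
    = density lborel (\<lambda>u. ennreal (if u > 0 then u powr ((a + b) / 4 - 1) * bessel_K ((a - b) / 2) (sqrt u)
        / (Gamma (a / 2) * Gamma (b / 2) * 2 powr (b / 2 + a / 2 - 1)) else 0))" (is "?M = density lborel ?h")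
proof -
  interpret qa: prob_space "chi_square a" by (rule prob_space_chi_square[OF a])
  interpret qb: prob_space "chi_square b" by (rule prob_space_chi_square[OF b])
  interpret ab: pair_prob_space "chi_square a" "chi_square b" ..
  have G: "Gamma (a / 2) > 0" "Gamma (b / 2) > 0"
    using a b by (auto intro!: Gamma_real_pos)
  \<comment> \<open>The joint density of (q v, v) at (u, v): for fixed v > 0, substituting q = u / v
    has Jacobian 1 / v. For v \<le> 0 the factor \<open>chi_square_density b v\<close> is 0.\<close>
  define H where "H u v = chi_square_density b v * chi_square_density a (u / v) / v" for u v
  define D where "D u = (\<integral>\<^sup>+v. ennreal (H u v) \<partial>lborel)" for u
  \<comment> \<open>With v = sqrt u * exp t, both v and u / v carry sqrt u, whence the exponent (b/2
    - 1)/2 + (a/2 - 1)/2 = (a+b)/4 - 1. The power of 2 is one less than in the product of the two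
    densities because folding at t = 0 returns a factor 2.\<close>
  define C where "C u = u powr ((a + b) / 4 - 1) / (Gamma (a / 2) * Gamma (b / 2) * 2 powr (b / 2 + a / 2 - 1))" for u
  define J where "J u = (\<integral>\<^sup>+t. ennreal (exp (- sqrt u * cosh t) * cosh ((a - b) / 2 * t)) * indicator {0<..} t \<partial>lborel)" for u
  have Hmeas [measurable]: "(\<lambda>(u, v). H u v) \<in> borel_measurable (borel \<Otimes>\<^sub>M borel)" unfolding H_def[abs_def] by measurable
  have [measurable]: "H u \<in> borel_measurable borel" for u unfolding H_def[abs_def] by measurable
  have [measurable]: "D \<in> borel_measurable borel" unfolding D_def[abs_def] by measurable
  have H0: "H u v \<ge> 0" for u v
  proof (cases "v > 0")
    case True
    then show ?thesis by (simp add: H_def chi_square_density_nonneg a b)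
  qed (simp add: H_def chi_square_density_def[of b])
  have M: "emeasure ?M A = (\<integral>\<^sup>+u. D u * indicator A u \<partial>lborel)" if [measurable]: "A \<in> sets borel" for A
  proof -
    have "emeasure ?M A = (\<integral>\<^sup>+w. indicator A (fst w * snd w) \<partial>(chi_square a \<Otimes>\<^sub>M chi_square b))"
      by (subst nn_integral_indicator[symmetric], simp, subst nn_integral_distr)
        (simp_all add: case_prod_unfold del: nn_integral_indicator)
    also have "\<dots> = (\<integral>\<^sup>+v. \<integral>\<^sup>+q. indicator A (q * v) \<partial>chi_square a \<partial>chi_square b)"
      by (subst ab.nn_integral_snd[symmetric]) simp_all
    also have "\<dots> = (\<integral>\<^sup>+v. ennreal (chi_square_density b v) *
        (\<integral>\<^sup>+q. ennreal (chi_square_density a q) * indicator A (q * v) \<partial>lborel) \<partial>lborel)"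
      unfolding chi_square_def by (subst (1 2) nn_integral_density) simp_all
    also have "\<dots> = (\<integral>\<^sup>+v. \<integral>\<^sup>+u. ennreal (H u v) * indicator A u \<partial>lborel \<partial>lborel)"
    proof (intro nn_integral_cong)
      fix v :: real
      show "ennreal (chi_square_density b v) * (\<integral>\<^sup>+q. ennreal (chi_square_density a q) * indicator A (q * v) \<partial>lborel)
         = (\<integral>\<^sup>+u. ennreal (H u v) * indicator A u \<partial>lborel)"
      proof (cases "v > 0")
        case False
        then show ?thesis by (simp add: H_def chi_square_density_def[of b])
      next
        case v: True
        have "(\<integral>\<^sup>+q. ennreal (chi_square_density a q) * indicator A (q * v) \<partial>lborel)
           = ennreal (1 / v) * (\<integral>\<^sup>+u. ennreal (chi_square_density a (u / v)) * indicator A u \<partial>lborel)"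
          using v by (subst nn_integral_real_affine[where c = "1 / v" and t = 0]) simp_all
        moreover have "ennreal (H u v) = ennreal (chi_square_density b v) * (ennreal (1 / v) * ennreal (chi_square_density a (u / v)))" for u
          using v by (simp add: H_def ennreal_mult[symmetric] chi_square_density_nonneg a b)
        ultimately show ?thesis
          by (simp add: mult.assoc nn_integral_cmult)
      qed
    qed
    also have "\<dots> = (\<integral>\<^sup>+u. \<integral>\<^sup>+v. ennreal (H u v) * indicator A u \<partial>lborel \<partial>lborel)"
      by (rule lborel_pair.Fubini') measurable
    also have "\<dots> = (\<integral>\<^sup>+u. D u * indicator A u \<partial>lborel)"
      by (simp add: D_def nn_integral_multc)
    finally show ?thesis .
  qed
  have DJ: "D u = ennreal (C u) * J u" if u: "u > 0" for u
  proof -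
    \<comment> \<open>This substitution makes the exponents v / 2 and u / (2 v) symmetric, with sum
      sqrt u * cosh t, and its derivative, v itself, cancels the 1 / v in \<open>H\<close>.\<close>
    let ?g = "\<lambda>t. sqrt u * exp t"
    have range: "range ?g = {0<..}"
    proof (intro equalityI subsetI)
      fix v :: real assume "v \<in> {0<..}"
      then show "v \<in> range ?g"
        using u by (intro image_eqI[of _ _ "ln (v / sqrt u)"]) auto
    qed (use u in auto)
    have "D u = (\<integral>\<^sup>+v. ennreal (H u v) * indicator (range ?g) v \<partial>lborel)"
      unfolding D_def range by (intro nn_integral_cong) (auto simp: H_def chi_square_density_def[of b] indicator_def)
    also have "\<dots> = (\<integral>\<^sup>+t. ennreal (\<bar>?g t\<bar> * H u (?g t)) * indicator UNIV t \<partial>lborel)"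
      by (rule nn_integral_change_of_variables) (use u in \<open>auto simp: range H0 inj_on_def intro!: derivative_eq_intros\<close>)
    \<comment> \<open>The integrand still runs over all real t and has exp in place of cosh. Adding
      the values at t and - t gives 2 cosh, which absorbs the 1/2; cosh is even, so b - a may become
      a - b.\<close>
    also have "\<dots> = (\<integral>\<^sup>+t. ennreal (C u / 2) * ennreal (exp (- sqrt u * cosh t) * exp ((b - a) / 2 * t)) \<partial>lborel)"
    proof (intro nn_integral_cong)
      fix t :: real
      have pos: "sqrt u * exp t > 0" "sqrt u * exp (- t) > 0" using u by auto
      have q: "u / (sqrt u * exp t) = sqrt u * exp (- t)"
        using u by (simp add: exp_minus field_simps)
      have e: "exp (- (sqrt u * exp t) / 2) * exp (- (sqrt u * exp (- t)) / 2) = exp (- sqrt u * cosh t)"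
        by (simp add: exp_add[symmetric] cosh_field_def field_simps)
      have p: "sqrt u powr x = u powr (x / 2)" for x
        using u by (simp add: powr_half_sqrt[symmetric] powr_powr mult.commute)
      have p1: "(sqrt u * exp t) powr (b / 2 - 1) * (sqrt u * exp (- t)) powr (a / 2 - 1)
         = u powr ((a + b) / 4 - 1) * exp ((b - a) / 2 * t)"
      proof -
        have "(b / 2 - 1) / 2 + (a / 2 - 1) / 2 = (a + b) / 4 - 1"
            "t * (b / 2 - 1) + - t * (a / 2 - 1) = (b - a) / 2 * t"
          by (simp_all add: field_simps)
        then have "u powr ((b / 2 - 1) / 2) * u powr ((a / 2 - 1) / 2) = u powr ((a + b) / 4 - 1)"
            "exp (t * (b / 2 - 1)) * exp (- t * (a / 2 - 1)) = exp ((b - a) / 2 * t)"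
          by (simp_all only: powr_add[symmetric] exp_add[symmetric])
        moreover have "(sqrt u * exp t) powr (b / 2 - 1) * (sqrt u * exp (- t)) powr (a / 2 - 1)
          = (u powr ((b / 2 - 1) / 2) * u powr ((a / 2 - 1) / 2)) * (exp (t * (b / 2 - 1)) * exp (- t * (a / 2 - 1)))"
          using u by (simp add: powr_mult p exp_powr_real mult_ac)
        ultimately show ?thesis by simp
      qed
      have p2: "2 powr (b / 2) * 2 powr (a / 2) = 2 * 2 powr (b / 2 + a / 2 - 1)"
        by (simp add: powr_add powr_diff)
      have "\<bar>?g t\<bar> * H u (?g t) = chi_square_density b (sqrt u * exp t) * chi_square_density a (sqrt u * exp (- t))"
        unfolding H_def q using u by simp
      also have "\<dots> = (sqrt u * exp t) powr (b / 2 - 1) * (sqrt u * exp (- t)) powr (a / 2 - 1)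
         * (exp (- (sqrt u * exp t) / 2) * exp (- (sqrt u * exp (- t)) / 2))
         / (Gamma (a / 2) * Gamma (b / 2) * (2 powr (b / 2) * 2 powr (a / 2)))"
        using pos by (simp add: chi_square_density_def mult_ac)
      also have "\<dots> = C u / 2 * (exp (- sqrt u * cosh t) * exp ((b - a) / 2 * t))"
        unfolding p1 e p2 C_def by (simp add: mult_ac)
      finally show "ennreal (\<bar>?g t\<bar> * H u (?g t)) * indicator UNIV t
         = ennreal (C u / 2) * ennreal (exp (- sqrt u * cosh t) * exp ((b - a) / 2 * t))"
        using G by (simp add: ennreal_mult[symmetric] C_def)
    qed
    also have "\<dots> = ennreal (C u / 2) * (\<integral>\<^sup>+t. ennreal (exp (- sqrt u * cosh t) * exp ((b - a) / 2 * t)) \<partial>lborel)"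
      by (rule nn_integral_cmult) measurable
    also have "(\<integral>\<^sup>+t. ennreal (exp (- sqrt u * cosh t) * exp ((b - a) / 2 * t)) \<partial>lborel) = 2 * J u"
    proof -
      have c: "exp (- x * cosh t) * exp (\<nu> * t) + exp (- x * cosh (- t)) * exp (\<nu> * - t)
        = 2 * (exp (- x * cosh t) * cosh (\<nu> * t))" for x t \<nu> :: real
        by (simp add: cosh_field_def field_simps)
      have "(a - b) / 2 * t = - ((b - a) / 2 * t)" for t by (simp add: field_simps)
      then have J: "J u = (\<integral>\<^sup>+t. ennreal (exp (- sqrt u * cosh t) * cosh ((b - a) / 2 * t)) * indicator {0<..} t \<partial>lborel)"
        unfolding J_def by (simp only: cosh_minus)
      show ?thesis
        unfolding J by (subst nn_integral_real_fold, measurable)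
          (simp only: ennreal_plus[symmetric] exp_ge_zero mult_nonneg_nonneg c, simp add: ennreal_mult mult.assoc nn_integral_cmult)
    qed
    also have "ennreal (C u / 2) * (2 * J u) = ennreal (C u) * J u"
    proof -
      have "ennreal (C u / 2) * 2 = ennreal (C u)"
        using G by (simp add: C_def flip: ennreal_numeral ennreal_mult)
      then show ?thesis by (simp add: mult.assoc[symmetric])
    qed
    finally show ?thesis .
  qed
  have "prob_space ?M" by (rule ab.prob_space_distr) measurable
  then have "(\<integral>\<^sup>+u. D u \<partial>lborel) = 1"
    using M[of UNIV] prob_space.emeasure_space_1[of ?M] by simp
  then have fin: "AE u in lborel. D u \<noteq> \<infinity>"
    by (intro nn_integral_PInf_AE) auto
  have hD: "AE u in lborel. D u = ?h u"
    using fin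
  proof eventually_elim
    fix u assume fin: "D u \<noteq> \<infinity>"
    show "D u = ?h u"
    proof (cases "u > 0")
      case False
      then have "H u v = 0" for v
        by (auto simp: H_def chi_square_density_def zero_less_divide_iff)
      then show ?thesis using False by (simp add: D_def)
    next
      case u: True
      have C: "C u > 0" using u G by (simp add: C_def)
      \<comment> \<open>Finiteness matters here: \<open>bessel_K\<close> is a Bochner integral and
        \<open>enn2real\<close> sends infinity to 0, so an infinite \<open>J u\<close> would be
        lost.\<close>
      have "J u \<noteq> \<infinity>" using fin C by (auto simp: DJ[OF u] ennreal_mult_eq_top_iff)
      moreover have "bessel_K ((a - b) / 2) (sqrt u) = enn2real (J u)"
        unfolding bessel_K_def set_lebesgue_integral_def J_def
        by (subst integral_eq_nn_integral)
          (auto intro!: arg_cong[where f = enn2real] nn_integral_cong simp: indicator_def)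
      ultimately have "ennreal (bessel_K ((a - b) / 2) (sqrt u)) = J u"
        by (simp add: less_top)
      then have "D u = ennreal (C u) * ennreal (bessel_K ((a - b) / 2) (sqrt u))"
        by (simp add: DJ[OF u])
      also have "\<dots> = ennreal (C u * bessel_K ((a - b) / 2) (sqrt u))"
        using C by (simp add: ennreal_mult')
      finally show ?thesis using u by (simp add: C_def)
    qed
  qed
  show ?thesis
  proof (rule measure_eqI)
    fix A assume "A \<in> sets ?M"
    then have [measurable]: "A \<in> sets borel" by simp
    have "density lborel ?h = density lborel D"
      using hD by (intro density_cong) auto
    then show "emeasure ?M A = emeasure (density lborel ?h) A"
      by (simp add: M emeasure_density)
  qed simp
qed

section \<open>Gaussian measures on Euclidean spaces\<close>

text \<open>Centred, with covariance s^2 times the identity; s is the standard deviation. Working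
  over any Euclidean space covers real numbers, vectors and whole sketching matrices at
  once.\<close>

definition gauss :: "real \<Rightarrow> 'a::euclidean_space measure" where
  "gauss s = density lborel (\<lambda>x. ennreal (\<Prod>b\<in>Basis. normal_density 0 s (x \<bullet> b)))"

lemma sets_gauss [simp, measurable_cong]: "sets (gauss s) = sets borel"
  by (simp add: gauss_def)

lemma space_gauss [simp]: "space (gauss s) = UNIV"
  by (simp add: gauss_def)

text \<open>The density depends on x through its norm alone: this is the rotational invariance that
  the resampling identity rests on.\<close>

lemma prod_normal_density:
  fixes x :: "'a::euclidean_space"
  shows "(\<Prod>b\<in>Basis. normal_density 0 s (x \<bullet> b))
    = exp (- (norm x)\<^sup>2 / (2 * s\<^sup>2)) / sqrt (2 * pi * s\<^sup>2) ^ DIM('a)"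
proof -
  have "(norm x)\<^sup>2 = (\<Sum>b\<in>Basis. (x \<bullet> b)\<^sup>2)"
    by (simp only: power2_norm_eq_inner) (subst euclidean_inner, simp add: power2_eq_square)
  then show ?thesis
    by (simp add: normal_density_def prod_dividef prod.distrib flip: exp_sum)
      (simp add: sum_negf sum_divide_distrib)
qed

lemma PiM_density:
  assumes I: "finite I" and M: "product_sigma_finite M"
    and D: "product_sigma_finite (\<lambda>i. density (M i) (f i))"
    and f [measurable]: "\<And>i. i \<in> I \<Longrightarrow> f i \<in> borel_measurable (M i)"
  shows "PiM I (\<lambda>i. density (M i) (f i)) = density (PiM I M) (\<lambda>x. \<Prod>i\<in>I. f i (x i))"
proof (rule product_sigma_finite.PiM_eqI[OF D I, symmetric])
  show "sets (density (PiM I M) (\<lambda>x. \<Prod>i\<in>I. f i (x i))) = sets (PiM I (\<lambda>i. density (M i) (f i)))"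
    by (simp cong: sets_PiM_cong)
  fix A assume "\<And>i. i \<in> I \<Longrightarrow> A i \<in> sets (density (M i) (f i))"
  then have A [measurable]: "\<And>i. i \<in> I \<Longrightarrow> A i \<in> sets (M i)" by simp
  have meas: "(\<lambda>x. \<Prod>i\<in>I. f i (x i)) \<in> borel_measurable (PiM I M)"
    using I by measurable
  have "emeasure (density (PiM I M) (\<lambda>x. \<Prod>i\<in>I. f i (x i))) (Pi\<^sub>E I A)
      = (\<integral>\<^sup>+x. (\<Prod>i\<in>I. f i (x i)) * indicator (Pi\<^sub>E I A) x \<partial>PiM I M)"
    using I by (intro emeasure_density meas sets_PiM_I_finite A) auto
  also have "\<dots> = (\<integral>\<^sup>+x. (\<Prod>i\<in>I. f i (x i) * indicator (A i) (x i)) \<partial>PiM I M)"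
  proof (intro nn_integral_cong)
    fix x assume x: "x \<in> space (PiM I M)"
    have "indicator (Pi\<^sub>E I A) x = (\<Prod>i\<in>I. indicator (A i) (x i) :: ennreal)"
    proof (cases "x \<in> Pi\<^sub>E I A")
      case True then show ?thesis by (auto simp: PiE_iff)
    next
      case False
      with x obtain i where "i \<in> I" "x i \<notin> A i" by (auto simp: space_PiM PiE_iff)
      then have "(\<Prod>i\<in>I. indicator (A i) (x i) :: ennreal) = 0"
        by (intro prod_zero[OF I] bexI[of _ i]) simp_all
      then show ?thesis using False by simp
    qed
    then show "(\<Prod>i\<in>I. f i (x i)) * indicator (Pi\<^sub>E I A) x = (\<Prod>i\<in>I. f i (x i) * indicator (A i) (x i))"
      by (simp add: prod.distrib)
  qed
  also have "\<dots> = (\<Prod>i\<in>I. \<integral>\<^sup>+x. f i x * indicator (A i) x \<partial>M i)"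
    using I by (intro product_sigma_finite.product_nn_integral_prod[OF M]) auto
  also have "\<dots> = (\<Prod>i\<in>I. emeasure (density (M i) (f i)) (A i))"
    by (intro prod.cong refl) (simp add: emeasure_density)
  finally show "emeasure (density (PiM I M) (\<lambda>x. \<Prod>i\<in>I. f i (x i))) (Pi\<^sub>E I A)
    = (\<Prod>i\<in>I. emeasure (density (M i) (f i)) (A i))" .
qed

text \<open>Lebesgue measure is itself the image of a product of real Lebesgue measures under the
  coordinate map; the product density is pulled back along this map and distributed over the
  factors. This yields both total mass 1 and the link to independent normal coordinates.\<close>

lemma gauss_eq_distr_PiM:
  assumes "s > 0"
  shows "gauss s = distr (\<Pi>\<^sub>M b\<in>Basis. density lborel (\<lambda>x. ennreal (normal_density 0 s x))) borel
    (\<lambda>f. \<Sum>b\<in>Basis. f b *\<^sub>R (b::'a::euclidean_space))"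
proof -
  have N: "prob_space (density lborel (\<lambda>x. ennreal (normal_density 0 s x)))"
    using assms by (rule prob_space_normal_density)
  have 1: "product_sigma_finite (\<lambda>b::'a. lborel :: real measure)" 
    by standard
  have 2: "product_sigma_finite (\<lambda>b::'a. density lborel (\<lambda>x. ennreal (normal_density 0 s x)))"
    unfolding product_sigma_finite_def using N prob_space_imp_sigma_finite by blast
  have [measurable]: "(\<lambda>f. \<Sum>b\<in>Basis. f b *\<^sub>R b) \<in> borel_measurable (\<Pi>\<^sub>M b\<in>(Basis::'a set). lborel)"
    by measurable
  have meas: "(\<lambda>x::'a. ennreal (\<Prod>b\<in>Basis. normal_density 0 s (x \<bullet> b))) \<in> borel_measurable borel"
    by measurable
  have "gauss s = density (distr (\<Pi>\<^sub>M b\<in>(Basis::'a set). lborel) borel (\<lambda>f. \<Sum>b\<in>Basis. f b *\<^sub>R b))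
     (\<lambda>x. ennreal (\<Prod>b\<in>Basis. normal_density 0 s (x \<bullet> b)))"
    unfolding gauss_def by (subst lborel_eq) simp
  also have "\<dots> = distr (density (\<Pi>\<^sub>M b\<in>(Basis::'a set). lborel)
     (\<lambda>f. ennreal (\<Prod>b\<in>Basis. normal_density 0 s ((\<Sum>b\<in>Basis. f b *\<^sub>R b) \<bullet> b)))) borel (\<lambda>f. \<Sum>b\<in>Basis. f b *\<^sub>R b)"
    by (rule density_distr[OF meas]) measurable
  also have "(\<lambda>f. ennreal (\<Prod>b\<in>Basis. normal_density 0 s ((\<Sum>b\<in>Basis. f b *\<^sub>R (b::'a)) \<bullet> b)))
     = (\<lambda>f. \<Prod>b\<in>Basis. ennreal (normal_density 0 s (f b)))"
    by (auto simp: fun_eq_iff inner_sum_left inner_Basis prod_ennreal if_distrib sum.delta' cong: if_cong)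
  also have "density (\<Pi>\<^sub>M b\<in>(Basis::'a set). lborel) (\<lambda>f. \<Prod>b\<in>Basis. ennreal (normal_density 0 s (f b)))
    = (\<Pi>\<^sub>M b\<in>Basis. density lborel (\<lambda>x. ennreal (normal_density 0 s x)))"
    by (rule PiM_density[OF finite_Basis 1 2, symmetric]) simp
  finally show ?thesis .
qed

lemma prob_space_gauss:
  assumes "s > 0"
  shows "prob_space (gauss s :: 'a::euclidean_space measure)"
proof -
  have "prob_space (\<Pi>\<^sub>M b\<in>(Basis::'a set). density lborel (\<lambda>x. ennreal (normal_density 0 s x)))"
    using assms by (intro prob_space_PiM prob_space_normal_density)
  then show ?thesis
    unfolding gauss_eq_distr_PiM[OF assms] by (rule prob_space.prob_space_distr) measurable
qed

lemma (in prob_space) distr_eq_gauss: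
  fixes Z :: "'a \<Rightarrow> 'b::euclidean_space"
  assumes s: "s > 0" and ind: "indep_vars (\<lambda>_. borel) (\<lambda>b \<omega>. Z \<omega> \<bullet> b) Basis"
    and D: "\<And>b. b \<in> Basis \<Longrightarrow> distributed M lborel (\<lambda>\<omega>. Z \<omega> \<bullet> b) (\<lambda>x. ennreal (normal_density 0 s x))"
  shows "distr M borel Z = gauss s"
proof -
  have rv [measurable]: "(\<lambda>\<omega>. Z \<omega> \<bullet> b) \<in> borel_measurable M" if "b \<in> Basis" for b
    using ind that by (auto simp: indep_vars_def)
  then have [measurable]: "Z \<in> borel_measurable M"
    by (subst borel_measurable_euclidean_space) auto
  have "distr M (\<Pi>\<^sub>M b\<in>Basis. borel) (\<lambda>\<omega>. \<lambda>b\<in>Basis. Z \<omega> \<bullet> b)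
    = (\<Pi>\<^sub>M b\<in>Basis. distr M borel (\<lambda>\<omega>. Z \<omega> \<bullet> b))"
    using ind by (subst (asm) indep_vars_iff_distr_eq_PiM') auto
  also have "\<dots> = (\<Pi>\<^sub>M b\<in>Basis. density lborel (\<lambda>x. ennreal (normal_density 0 s x)))"
  proof (intro PiM_cong refl)
    fix b :: 'b assume "b \<in> Basis"
    then have "distr M lborel (\<lambda>\<omega>. Z \<omega> \<bullet> b) = density lborel (\<lambda>x. ennreal (normal_density 0 s x))"
      using D by (auto simp: distributed_def)
    then show "distr M borel (\<lambda>\<omega>. Z \<omega> \<bullet> b) = density lborel (\<lambda>x. ennreal (normal_density 0 s x))"
      by (simp cong: distr_cong)
  qed
  finally have eq: "(\<Pi>\<^sub>M b\<in>Basis. density lborel (\<lambda>x. ennreal (normal_density 0 s x)))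
     = distr M (\<Pi>\<^sub>M b\<in>Basis. borel) (\<lambda>\<omega>. \<lambda>b\<in>Basis. Z \<omega> \<bullet> b)" ..
  have "gauss s = distr M borel ((\<lambda>f. \<Sum>b\<in>Basis. f b *\<^sub>R b) \<circ> (\<lambda>\<omega>. \<lambda>b\<in>Basis. Z \<omega> \<bullet> b))"
    unfolding gauss_eq_distr_PiM[OF s] eq by (rule distr_distr) measurable
  also have "\<dots> = distr M borel Z"
    by (intro distr_cong refl) (simp add: euclidean_representation)
  finally show ?thesis ..
qed

section \<open>Shears of Lebesgue measure and resampling of a Gaussian component\<close>

lemma nn_integral_lborel_plus:
  fixes c :: "'a::euclidean_space"
  assumes [measurable]: "f \<in> borel_measurable borel"
  shows "(\<integral>\<^sup>+x. f (x + c) \<partial>lborel) = (\<integral>\<^sup>+x. f x \<partial>lborel)"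
  by (subst (2) lborel_distr_plus[of c, symmetric]) (simp add: nn_integral_distr add.commute)

text \<open>Integrating over the moved coordinate first, the shear is a translation by a
  constant.\<close>

lemma nn_integral_shear_fst:
  fixes f :: "'a::euclidean_space \<times> 'b::euclidean_space \<Rightarrow> ennreal"
  assumes [measurable]: "f \<in> borel_measurable borel" "\<phi> \<in> borel_measurable borel"
  shows "(\<integral>\<^sup>+z. f (fst z + \<phi> (snd z), snd z) \<partial>lborel) = (\<integral>\<^sup>+z. f z \<partial>lborel)"
proof -
  have [measurable]: "f \<in> borel_measurable (borel \<Otimes>\<^sub>M borel)"
    by (simp add: borel_prod)
  have f: "f \<in> borel_measurable (lborel \<Otimes>\<^sub>M lborel)"
    by (simp add: lborel_prod)
  have "(\<integral>\<^sup>+z. f (fst z + \<phi> (snd z), snd z) \<partial>lborel)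
      = (\<integral>\<^sup>+y. \<integral>\<^sup>+x. f (x + \<phi> y, y) \<partial>lborel \<partial>lborel)"
    unfolding lborel_prod[symmetric] by (subst lborel_pair.nn_integral_snd[symmetric]) simp_all
  also have "\<dots> = (\<integral>\<^sup>+y. \<integral>\<^sup>+x. f (x, y) \<partial>lborel \<partial>lborel)"
    by (intro nn_integral_cong nn_integral_lborel_plus[where f = "\<lambda>x. f (x, _)"]) measurable
  also have "\<dots> = (\<integral>\<^sup>+z. f z \<partial>lborel)"
    unfolding lborel_prod[symmetric] by (subst lborel_pair.nn_integral_snd) (simp_all add: f)
  finally show ?thesis .
qed

lemma nn_integral_shear_snd:
  fixes f :: "'a::euclidean_space \<times> 'b::euclidean_space \<Rightarrow> ennreal"
  assumes [measurable]: "f \<in> borel_measurable borel" "\<phi> \<in> borel_measurable borel"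
  shows "(\<integral>\<^sup>+z. f (fst z, snd z + \<phi> (fst z)) \<partial>lborel) = (\<integral>\<^sup>+z. f z \<partial>lborel)"
proof -
  have [measurable]: "f \<in> borel_measurable (borel \<Otimes>\<^sub>M borel)"
    by (simp add: borel_prod)
  have f: "f \<in> borel_measurable (lborel \<Otimes>\<^sub>M lborel)"
    by (simp add: lborel_prod)
  have "(\<integral>\<^sup>+z. f (fst z, snd z + \<phi> (fst z)) \<partial>lborel)
      = (\<integral>\<^sup>+x. \<integral>\<^sup>+y. f (x, y + \<phi> x) \<partial>lborel \<partial>lborel)"
    unfolding lborel_prod[symmetric] by (subst lborel.nn_integral_fst[symmetric]) simp_all
  also have "\<dots> = (\<integral>\<^sup>+x. \<integral>\<^sup>+y. f (x, y) \<partial>lborel \<partial>lborel)"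
    by (intro nn_integral_cong nn_integral_lborel_plus[where f = "\<lambda>y. f (_, y)"]) measurable
  also have "\<dots> = (\<integral>\<^sup>+z. f z \<partial>lborel)"
    unfolding lborel_prod[symmetric] by (subst lborel.nn_integral_fst) (simp_all add: f)
  finally show ?thesis .
qed

text \<open>\<open>(z, g) \<mapsto> (z - A B z + A g, - B z)\<close> is a composition of three shears, hence preserves
  Lebesgue measure, and it is an isometry, hence preserves the Gaussian density.\<close>

lemma nn_integral_gauss_swap:
  fixes A :: "'b::euclidean_space \<Rightarrow> 'a::euclidean_space" and B :: "'a \<Rightarrow> 'b"
  assumes s: "s > 0" and lin: "linear A" "linear B"
    and adj: "\<And>x y. A y \<bullet> x = y \<bullet> B x" and iso: "\<And>y. B (A y) = y"
    and f [measurable]: "f \<in> borel_measurable borel"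
  shows "(\<integral>\<^sup>+z. \<integral>\<^sup>+g. f (z - A (B z) + A g) \<partial>gauss s \<partial>gauss s) = (\<integral>\<^sup>+z. f z \<partial>gauss s)"
proof -
  have [measurable]: "A \<in> borel_measurable borel" "B \<in> borel_measurable borel"
    using lin by (auto intro!: borel_measurable_continuous_onI linear_continuous_on simp: linear_conv_bounded_linear)
  interpret ga: prob_space "gauss s :: 'a measure" by (rule prob_space_gauss[OF s])
  interpret gb: prob_space "gauss s :: 'b measure" by (rule prob_space_gauss[OF s])
  define d :: "'a \<Rightarrow> real" where "d x = (\<Prod>b\<in>Basis. normal_density 0 s (x \<bullet> b))" for x
  define e :: "'b \<Rightarrow> real" where "e x = (\<Prod>b\<in>Basis. normal_density 0 s (x \<bullet> b))" for x
  have [measurable]: "d \<in> borel_measurable borel" "e \<in> borel_measurable borel"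
    unfolding d_def[abs_def] e_def[abs_def] by measurable
  have nn: "d x \<ge> 0" "e y \<ge> 0" for x y unfolding d_def e_def by (auto intro!: prod_nonneg)
  \<comment> \<open>A B z is the orthogonal projection of z to the range of A, and A preserves
    norms, so the pair after the swap has the same total squared norm as (z, g).\<close>
  have inv: "d (z - A (B z) + A g) * e (- B z) = d z * e g" for z g
  proof -
    have zA: "z \<bullet> A y = B z \<bullet> y" for z y by (metis adj inner_commute)
    have BL: "B (z - A (B z) + A g) = g"
      by (simp add: linear_add[OF lin(2)] linear_diff[OF lin(2)] iso)
    have "(norm (z - A (B z) + A g))\<^sup>2 + (norm (B z))\<^sup>2 = (norm z)\<^sup>2 + (norm g)\<^sup>2"
      unfolding power2_norm_eq_inner
      by (simp add: inner_diff_left inner_diff_right inner_add_left inner_add_right adj zA iso BL inner_commute)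
    then have *: "- (norm (z - A (B z) + A g))\<^sup>2 / (2 * s\<^sup>2) + - (norm (- B z))\<^sup>2 / (2 * s\<^sup>2)
      = - (norm z)\<^sup>2 / (2 * s\<^sup>2) + - (norm g)\<^sup>2 / (2 * s\<^sup>2)"
      unfolding add_divide_distrib[symmetric] norm_minus_cancel by (metis minus_add_distrib)
    show ?thesis
      unfolding d_def e_def prod_normal_density times_divide_times_eq exp_add[symmetric] * ..
  qed
  \<comment> \<open>An auxiliary coordinate g with density e of mass 1 is added, so that the shears
    act on a pair.\<close>
  define F where "F = (\<lambda>w. f (fst w) * (ennreal (d (fst w)) * ennreal (e (snd w))))"
  have F [measurable]: "F \<in> borel_measurable borel" unfolding F_def by (simp add: borel_prod[symmetric])
  have F2: "F \<in> borel_measurable (lborel \<Otimes>\<^sub>M lborel)"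
    by (simp add: lborel_prod)
  have e1: "(\<integral>\<^sup>+g. ennreal (e g) \<partial>lborel) = 1"
    using gb.emeasure_space_1 by (simp add: gauss_def emeasure_density flip: e_def)
  have "(\<integral>\<^sup>+z. f z \<partial>gauss s) = (\<integral>\<^sup>+z. f z * ennreal (d z) \<partial>lborel)"
    by (simp add: gauss_def nn_integral_density mult.commute flip: d_def)
  also have "\<dots> = (\<integral>\<^sup>+z. \<integral>\<^sup>+g. F (z, g) \<partial>lborel \<partial>lborel)"
    by (simp add: F_def nn_integral_cmult e1)
  also have "\<dots> = (\<integral>\<^sup>+w. F w \<partial>lborel)"
    unfolding lborel_prod[symmetric] by (subst lborel.nn_integral_fst) (simp_all add: F2)
  \<comment> \<open>The resulting map is: add A g to z, then subtract B z from g, then add A g to z.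
    Since B A is the identity, the second coordinate becomes - B z, and the first z + A g - A B
    z.\<close>
  also have "\<dots> = (\<integral>\<^sup>+w. F (fst w + A (snd w), snd w) \<partial>lborel)"
    by (rule nn_integral_shear_fst[symmetric]) measurable
  also have "\<dots> = (\<integral>\<^sup>+w. F (fst w + A (snd w - B (fst w)), snd w - B (fst w)) \<partial>lborel)"
    using nn_integral_shear_snd[of "\<lambda>w. F (fst w + A (snd w), snd w)" "\<lambda>z. - B z"]
    by (simp add: borel_prod[symmetric])
  also have "\<dots> = (\<integral>\<^sup>+w. F (fst w + A (snd w) + A (snd w - B (fst w + A (snd w))), snd w - B (fst w + A (snd w))) \<partial>lborel)"
    using nn_integral_shear_fst[of "\<lambda>w. F (fst w + A (snd w - B (fst w)), snd w - B (fst w))" A]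
    by (simp add: borel_prod[symmetric])
  also have "\<dots> = (\<integral>\<^sup>+w. f (fst w - A (B (fst w)) + A (snd w)) * (ennreal (d (fst w)) * ennreal (e (snd w))) \<partial>lborel)"
  proof -
    have 1: "g - B (z + A g) = - B z" for z g
      by (simp add: linear_add[OF lin(2)] iso)
    have 2: "z + A g + A (- B z) = z - A (B z) + A g" for z g
      by (simp add: linear_neg[OF lin(1)])
    show ?thesis
      unfolding 1 2 F_def fst_conv snd_conv by (simp add: inv nn flip: ennreal_mult)
  qed
  also have "\<dots> = (\<integral>\<^sup>+z. \<integral>\<^sup>+g. f (z - A (B z) + A g) * (ennreal (d z) * ennreal (e g)) \<partial>lborel \<partial>lborel)"
    unfolding lborel_prod[symmetric] by (subst lborel.nn_integral_fst[symmetric]) simp_all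
  also have "\<dots> = (\<integral>\<^sup>+z. \<integral>\<^sup>+g. f (z - A (B z) + A g) \<partial>gauss s \<partial>gauss s)"
    by (simp add: gauss_def nn_integral_density flip: d_def e_def)
      (simp add: ac_simps nn_integral_cmult)
  finally show ?thesis ..
qed

section \<open>Residual sums of squares\<close>

lemma inner_matrix_vector:
  fixes A :: "real ^ 'p ^ 'm"
  shows "(A *v x) \<bullet> y = x \<bullet> (transpose A *v y)"
  by (simp add: dot_lmul_matrix[symmetric] inner_commute)

text \<open>If W^T W x = 0 then |W x|^2 = 0. The inverse in \<open>SSR\<close> asks for the
  determinant, rank and line arguments ask for injectivity; this passes between them.\<close>

lemma det_gram_nonzero_iff:
  fixes W :: "real ^ 'p ^ 'm"
  shows "det (transpose W ** W) \<noteq> 0 \<longleftrightarrow> inj ((*v) W)"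
proof -
  have "(transpose W ** W) *v x = 0 \<longleftrightarrow> W *v x = 0" for x
  proof
    assume "(transpose W ** W) *v x = 0"
    then have "(W *v x) \<bullet> (W *v x) = 0"
      by (simp only: inner_matrix_vector matrix_vector_mul_assoc inner_zero_right)
    then show "W *v x = 0" by simp
  next
    assume "W *v x = 0"
    then show "(transpose W ** W) *v x = 0"
      by (simp only: matrix_vector_mul_assoc[symmetric] matrix_vector_mult_0_right)
  qed
  then show ?thesis
    unfolding invertible_det_nz[symmetric] invertible_left_inverse matrix_left_invertible_ker
      matrix_left_invertible_injective[symmetric] by simp
qed

lemma matrix_mul_matrix_inv:
  fixes A :: "real ^ 'n ^ 'n"
  assumes "det A \<noteq> 0"
  shows "A ** matrix_inv A = mat 1"
proof -
  have "\<exists>A'. A ** A' = mat 1 \<and> A' ** A = mat 1"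
    using assms by (simp only: invertible_det_nz[symmetric] invertible_def)
  from someI_ex[OF this] show ?thesis
    by (simp add: matrix_inv_def)
qed

text \<open>Here b solves the normal equations and r is the least squares residual; the cross term
  between r and the fitted value W b vanishes.\<close>

lemma residual_decomposition:
  fixes W :: "real ^ 'p ^ 'm"
  assumes W: "det (transpose W ** W) \<noteq> 0"
  obtains r b where "v = r + W *v b" "transpose W *v r = 0" "SSR W v = (norm r)\<^sup>2"
proof -
  let ?G = "transpose W ** W"
  have G: "?G ** matrix_inv ?G = mat 1"
    using W by (rule matrix_mul_matrix_inv)
  define b where "b = matrix_inv ?G *v (transpose W *v v)"
  have 0: "transpose W *v (v - W *v b) = 0"
    unfolding b_def by (simp only: matrix_vector_mult_diff_distrib matrix_vector_mul_assoc G matrix_mul_assoc matrix_mul_lid)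
      simp
  have "SSR W v = v \<bullet> (v - W *v b)"
    by (simp only: SSR_def b_def matrix_vector_mult_diff_rdistrib matrix_vector_mul_lid matrix_vector_mul_assoc matrix_mul_assoc)
  also have "\<dots> = (v - W *v b) \<bullet> (v - W *v b) + (W *v b) \<bullet> (v - W *v b)"
    by (simp add: inner_diff_left)
  also have "(W *v b) \<bullet> (v - W *v b) = 0"
    unfolding inner_matrix_vector 0 by simp
  finally show thesis
    using 0 by (intro that[of "v - W *v b" b]) (simp_all add: power2_norm_eq_inner)
qed

text \<open>B is an orthonormal basis of the orthogonal complement of the column space, chosen once
  for all v. In this form \<open>SSR\<close> is visibly a sum of m - p squared coordinates.\<close>

lemma SSR_eq_sum_orthonormal:
  fixes W :: "real ^ 'p ^ 'm"
  assumes W: "det (transpose W ** W) \<noteq> 0"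
  obtains B where "finite B" "pairwise orthogonal B" "\<And>b. b \<in> B \<Longrightarrow> norm b = 1"
    "card B + CARD('p) = CARD('m)" "\<And>b x. b \<in> B \<Longrightarrow> b \<bullet> (W *v x) = 0"
    "\<And>v. SSR W v = (\<Sum>b\<in>B. (v \<bullet> b)\<^sup>2)"
proof -
  define V where "V = range ((*v) W)"
  have V: "subspace V" unfolding V_def by (intro linear_subspace_image matrix_vector_mul_linear subspace_UNIV)
  have "dim V = CARD('p)"
    using W by (simp only: det_gram_nonzero_iff full_rank_injective[symmetric] rank_dim_range V_def)
  moreover have "dim {y \<in> UNIV. \<forall>x\<in>V. orthogonal x y} + dim V = dim (UNIV :: (real ^ 'm) set)"
    by (rule dim_subspace_orthogonal_to_vectors[OF V subspace_UNIV]) simp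
  ultimately have dim: "dim {y. \<forall>x\<in>V. orthogonal x y} + CARD('p) = CARD('m)"
    by simp
  have "subspace {y. \<forall>x\<in>V. orthogonal x y}"
    by (auto simp: subspace_def orthogonal_def inner_simps)
  then obtain B where B: "B \<subseteq> {y. \<forall>x\<in>V. orthogonal x y}" "pairwise orthogonal B" "\<And>b. b \<in> B \<Longrightarrow> norm b = 1"
    "independent B" "card B = dim {y. \<forall>x\<in>V. orthogonal x y}" "span B = {y. \<forall>x\<in>V. orthogonal x y}"
    by (metis (no_types, lifting) orthonormal_basis_subspace)
  have fin: "finite B" using B(4) by (rule independent_imp_finite)
  have BW: "b \<bullet> (W *v x) = 0" if "b \<in> B" for b x
    using B(1) that by (auto simp: V_def orthogonal_def inner_commute)
  have "SSR W v = (\<Sum>b\<in>B. (v \<bullet> b)\<^sup>2)" for v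
  proof -
    obtain r b where r: "v = r + W *v b" "transpose W *v r = 0" "SSR W v = (norm r)\<^sup>2"
      using residual_decomposition[OF W] .
    have "(W *v x) \<bullet> r = 0" for x
      unfolding inner_matrix_vector r(2) by simp
    then have rB: "r \<in> span B"
      unfolding B(6) by (auto simp: V_def orthogonal_def)
    have "SSR W v = (\<Sum>b\<in>B. (r \<bullet> b) *\<^sub>R b) \<bullet> r"
      using orthonormal_basis_expand[OF B(2,3) rB fin] by (simp add: r(3) power2_norm_eq_inner)
    also have "\<dots> = (\<Sum>b\<in>B. (r \<bullet> b)\<^sup>2)"
      by (simp add: inner_sum_left inner_sum_right power2_eq_square inner_commute[of _ r])
    also have "\<dots> = (\<Sum>b\<in>B. (v \<bullet> b)\<^sup>2)"
      using BW by (intro sum.cong refl) (simp add: r(1) inner_add_left inner_commute[of "W *v _"])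
    finally show ?thesis .
  qed
  moreover have "card B + CARD('p) = CARD('m)"
    using dim by (simp only: B(5))
  ultimately show thesis
    using fin B(2,3) BW by (intro that)
qed

text \<open>Each b in B is orthogonal to the column space. This removes the mean X \<beta> from the
  response and the fitted part from the sketched response.\<close>

lemma SSR_add_column_space:
  fixes W :: "real ^ 'p ^ 'm"
  assumes W: "det (transpose W ** W) \<noteq> 0"
  shows "SSR W (v + W *v x) = SSR W v"
proof -
  obtain B where B: "\<And>b x. b \<in> B \<Longrightarrow> b \<bullet> (W *v x) = 0" "\<And>v. SSR W v = (\<Sum>b\<in>B. (v \<bullet> b)\<^sup>2)"
    using SSR_eq_sum_orthonormal[OF W] by metis
  then show ?thesis
    unfolding B(2) by (intro sum.cong refl) (simp add: inner_add_left inner_commute[of "W *v x"])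
qed

lemma SSR_scaleR: "SSR W (c *\<^sub>R v) = c\<^sup>2 * SSR W v"
  by (simp add: SSR_def matrix_vector_mult_scaleR power2_eq_square)

text \<open>By translation invariance the measure of the zero set N is the average over 0 \<le> t
  \<le> 1 of the measures of its translates along e. Exchanging integrals leaves, for each x, the
  length of the part of a segment in direction e that lies in N, which is 0.\<close>

lemma AE_lborel_nonzero_on_lines:
  fixes f :: "'a::euclidean_space \<Rightarrow> real"
  assumes [measurable]: "f \<in> borel_measurable borel"
    and fin: "\<And>x. countable {t. f (x + t *\<^sub>R e) = 0}"
  shows "AE x in lborel. f x \<noteq> 0"
proof -
  let ?N = "{x. f x = 0}"
  have N [measurable]: "?N \<in> sets borel" by measurable
  have line: "(\<integral>\<^sup>+t. indicator {0..1} t * indicator ?N (x + t *\<^sub>R e) \<partial>lborel) = (0::ennreal)" for x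
  proof -
    have "AE t in lborel. t \<notin> {t. f (x + t *\<^sub>R e) = 0}"
      using fin by (intro AE_not_in countable_imp_null_set_lborel)
    then have "AE t in lborel. indicator {0..1} t * indicator ?N (x + t *\<^sub>R e) = (0::ennreal)"
      by eventually_elim simp
    then show ?thesis by (subst nn_integral_0_iff_AE) auto
  qed
  have tr: "(\<integral>\<^sup>+x. indicator ?N (x + t *\<^sub>R e) \<partial>lborel) = emeasure lborel ?N" for t
  proof -
    have "emeasure lborel ?N = emeasure (distr lborel borel ((+) (t *\<^sub>R e))) ?N"
      by (simp add: lborel_distr_plus)
    also have "\<dots> = (\<integral>\<^sup>+x. indicator ?N (t *\<^sub>R e + x) \<partial>lborel)"
      by (rule emeasure_distr_nn_integral) simp_all
    finally show ?thesis by (simp add: add.commute)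
  qed
  have "emeasure lborel ?N = (\<integral>\<^sup>+t. indicator {0..1} t * emeasure lborel ?N \<partial>(lborel :: real measure))"
    by (subst nn_integral_multc) simp_all
  also have "\<dots> = (\<integral>\<^sup>+t. \<integral>\<^sup>+x. indicator {0..1} t * indicator ?N (x + t *\<^sub>R e) \<partial>lborel \<partial>lborel)"
    by (subst nn_integral_cmult) (simp_all add: tr)
  also have "\<dots> = (\<integral>\<^sup>+x. \<integral>\<^sup>+t. indicator {0..1} t * indicator ?N (x + t *\<^sub>R e) \<partial>lborel \<partial>lborel)"
    by (rule lborel_pair.Fubini') measurable
  also have "\<dots> = 0" by (simp add: line)
  finally have "emeasure lborel ?N = 0" .
  then show ?thesis
    by (intro AE_I[of _ _ ?N]) auto
qed

lemma poly_det: "poly (det P) s = det (\<chi> i j. poly (P $ i $ j) s)"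
  for P :: "real poly ^ 'p ^ 'p"
  by (simp add: det_def poly_sum poly_prod)

text \<open>For t \<noteq> 0, U + t V is t times V + s U with s = 1 / t. The Gram determinant of V +
  s U is a polynomial in s that is nonzero at s = 0 because V is injective, so it has finitely many
  roots; t = 0 is added to the exceptional set by hand.\<close>

lemma finite_singular_on_line:
  fixes U V :: "real ^ 'p ^ 'm"
  assumes V: "inj ((*v) V)"
  shows "finite {t. \<not> inj ((*v) (U + t *\<^sub>R V))}"
proof -
  \<comment> \<open>The Gram matrix of V + s U with polynomial entries; \<open>[:c, d:]\<close>
    stands for c + d s.\<close>
  define P :: "real poly ^ 'p ^ 'p" where
    "P = (\<chi> a b. \<Sum>i\<in>UNIV. [:V $ i $ a, U $ i $ a:] * [:V $ i $ b, U $ i $ b:])"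
  have P: "poly (det P) s = det (transpose (V + s *\<^sub>R U) ** (V + s *\<^sub>R U))" for s
    unfolding poly_det P_def
    by (intro arg_cong[where f = det])
      (simp add: poly_sum matrix_matrix_mult_def transpose_def vec_eq_iff algebra_simps)
  have "poly (det P) 0 \<noteq> 0"
    unfolding P using V by (simp add: det_gram_nonzero_iff)
  then have "det P \<noteq> 0" by auto
  then have "finite {s. poly (det P) s = 0}" by (rule poly_roots_finite)
  then have "finite (insert 0 (inverse ` {s. poly (det P) s = 0}))" by simp
  moreover have "{t. \<not> inj ((*v) (U + t *\<^sub>R V))} \<subseteq> insert 0 (inverse ` {s. poly (det P) s = 0})"
  proof (intro subsetI insertCI)
    fix t assume t: "t \<in> {t. \<not> inj ((*v) (U + t *\<^sub>R V))}" and "t \<notin> inverse ` {s. poly (det P) s = 0}"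
    then have nz: "poly (det P) (inverse t) \<noteq> 0" by (force simp: image_iff)
    show "t = 0"
    proof (rule ccontr)
      assume "t \<noteq> 0"
      then have eq: "U + t *\<^sub>R V = t *\<^sub>R (V + inverse t *\<^sub>R U)"
        by (simp add: scaleR_add_right)
      have "inj ((*v) (V + inverse t *\<^sub>R U))"
        using nz unfolding P det_gram_nonzero_iff .
      then have "inj ((*v) (U + t *\<^sub>R V))"
        unfolding eq using \<open>t \<noteq> 0\<close> by (simp add: inj_on_def flip: scaleR_matrix_vector_assoc)
      then show False using t by simp
    qed
  qed
  ultimately show ?thesis by (rule finite_subset[rotated])
qed

section \<open>Measurability of matrix operations and of residual sums of squares\<close>

lemma borel_measurable_vec_nth [measurable (raw)]:
  fixes f :: "'a \<Rightarrow> 'b::euclidean_space ^ 'n"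
  assumes "f \<in> borel_measurable M"
  shows "(\<lambda>x. f x $ i) \<in> borel_measurable M"
  using assms by (rule measurable_compose) (intro borel_measurable_continuous_onI continuous_intros)

lemma borel_measurable_det [measurable (raw)]:
  fixes f :: "'a \<Rightarrow> real ^ 'n ^ 'n"
  assumes [measurable]: "\<And>i j. (\<lambda>x. f x $ i $ j) \<in> borel_measurable M"
  shows "(\<lambda>x. det (f x)) \<in> borel_measurable M"
  unfolding det_def by measurable

lemma borel_measurable_matrix_mult_nth [measurable (raw)]:
  fixes f :: "'a \<Rightarrow> real ^ 'n ^ 'm" and g :: "'a \<Rightarrow> real ^ 'p ^ 'n"
  assumes [measurable]: "\<And>i j. (\<lambda>x. f x $ i $ j) \<in> borel_measurable M"
    "\<And>i j. (\<lambda>x. g x $ i $ j) \<in> borel_measurable M"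
  shows "(\<lambda>x. (f x ** g x) $ i $ j) \<in> borel_measurable M"
  unfolding matrix_matrix_mult_def by simp

lemma borel_measurable_matrix_vector_mult_nth [measurable (raw)]:
  fixes f :: "'a \<Rightarrow> real ^ 'n ^ 'm" and g :: "'a \<Rightarrow> real ^ 'n"
  assumes [measurable]: "\<And>i j. (\<lambda>x. f x $ i $ j) \<in> borel_measurable M"
    "\<And>i. (\<lambda>x. g x $ i) \<in> borel_measurable M"
  shows "(\<lambda>x. (f x *v g x) $ i) \<in> borel_measurable M"
  unfolding matrix_vector_mult_def by simp

lemma borel_measurable_transpose_nth [measurable (raw)]:
  fixes f :: "'a \<Rightarrow> real ^ 'n ^ 'm"
  assumes [measurable]: "\<And>i j. (\<lambda>x. f x $ i $ j) \<in> borel_measurable M"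
  shows "(\<lambda>x. transpose (f x) $ i $ j) \<in> borel_measurable M"
  unfolding transpose_def by simp

text \<open>Cramer's rule for the columns of the inverse. For singular A the predicate under the
  choice operator is constantly false, so the chosen matrix does not depend on A; the inverse is
  thus measurable on all matrices.\<close>

lemma matrix_inv_nth:
  fixes A :: "real ^ 'n ^ 'n"
  shows "matrix_inv A $ k $ j = (if det A = 0 then (SOME B :: real ^ 'n ^ 'n. False) $ k $ j
    else det (\<chi> i l. if l = k then axis j 1 $ i else A $ i $ l) / det A)"
proof (cases "det A = 0")
  case True
  then have "(\<lambda>B. A ** B = mat 1 \<and> B ** A = mat 1) = (\<lambda>_. False)"
    using invertible_det_nz[of A] by (auto simp: invertible_def)
  then show ?thesis using True by (simp add: matrix_inv_def)
next
  case False
  then have "A ** matrix_inv A = mat 1"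
    by (rule matrix_mul_matrix_inv)
  then have "A *v (matrix_inv A *v axis j 1) = axis j 1"
    by (simp add: matrix_vector_mul_assoc)
  then have "matrix_inv A *v axis j 1 = (\<chi> k. det (\<chi> i l. if l = k then axis j 1 $ i else A $ i $ l) / det A)"
    by (subst (asm) cramer[OF False])
  then have "(matrix_inv A *v axis j 1) $ k = det (\<chi> i l. if l = k then axis j 1 $ i else A $ i $ l) / det A"
    by simp
  then show ?thesis using False by (simp add: matrix_vector_mult_basis column_def)
qed

lemma borel_measurable_matrix_inv_nth [measurable (raw)]:
  fixes f :: "'a \<Rightarrow> real ^ 'n ^ 'n"
  assumes [measurable]: "\<And>i j. (\<lambda>x. f x $ i $ j) \<in> borel_measurable M"
  shows "(\<lambda>x. matrix_inv (f x) $ i $ j) \<in> borel_measurable M"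
proof -
  have [measurable]: "(\<lambda>x. det (\<chi> i' l. if l = i then axis j 1 $ i' else f x $ i' $ l)) \<in> borel_measurable M"
    by (rule borel_measurable_det) auto
  show ?thesis unfolding matrix_inv_nth by measurable
qed

lemma borel_measurable_SSR [measurable (raw)]:
  fixes W :: "'a \<Rightarrow> real ^ 'p ^ 'm" and v :: "'a \<Rightarrow> real ^ 'm"
  assumes [measurable]: "\<And>i j. (\<lambda>x. W x $ i $ j) \<in> borel_measurable M"
    "\<And>i. (\<lambda>x. v x $ i) \<in> borel_measurable M"
  shows "(\<lambda>x. SSR (W x) (v x)) \<in> borel_measurable M"
proof -
  have "SSR (W x) (v x) = (\<Sum>i\<in>UNIV. v x $ i * (v x $ i -
      ((W x ** matrix_inv (transpose (W x) ** W x) ** transpose (W x)) *v v x) $ i))" for x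
    by (simp add: SSR_def inner_vec_def matrix_vector_mult_diff_rdistrib)
  then show ?thesis by (simp only:) measurable
qed

text \<open>The direction for the line argument is F L, where L is a left inverse of X and F is
  injective, which p \<le> k allows. Then (S + t F L) X = S X + t F, which is singular for finitely
  many t only.\<close>

lemma AE_sketch_full_rank:
  fixes X :: "real ^ 'p ^ 'n"
  assumes X: "inj ((*v) X)" and card: "CARD('p) \<le> CARD('k)"
  shows "AE S in (lborel :: (real ^ 'n ^ 'k) measure). det (transpose (S ** X) ** (S ** X)) \<noteq> 0"
proof -
  obtain L where L: "L ** X = mat 1"
    using X matrix_left_invertible_injective by blast
  obtain g :: "'p \<Rightarrow> 'k" where g: "inj g"
    using card card_le_inj[of "UNIV :: 'p set" "UNIV :: 'k set"] by auto
  \<comment> \<open>The coordinate embedding that sends the j-th unit vector to the one with index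
    \<open>g j\<close>.\<close>
  define F :: "real ^ 'p ^ 'k" where "F = (\<chi> i j. if i = g j then 1 else 0)"
  have "(F *v x) $ g j = x $ j" for x j
    using g by (simp add: F_def matrix_vector_mult_def inj_eq of_bool_def[symmetric] sum.delta')
  then have F: "inj ((*v) F)"
    by (intro injI) (metis vec_eq_iff)
  have FLX: "F ** L ** X = F" using L by (simp add: matrix_mul_assoc[symmetric])
  show ?thesis
  proof (rule AE_lborel_nonzero_on_lines[where e = "F ** L"])
    show "(\<lambda>S::real ^ 'n ^ 'k. det (transpose (S ** X) ** (S ** X))) \<in> borel_measurable borel"
      by measurable
    fix S :: "real ^ 'n ^ 'k"
    have "(S + t *\<^sub>R (F ** L)) ** X = S ** X + t *\<^sub>R F" for t
    proof -
      have "(S + t *\<^sub>R E) ** X = S ** X + t *\<^sub>R (E ** X)" for E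
        by (simp add: matrix_matrix_mult_def vec_eq_iff distrib_right sum.distrib sum_distrib_left mult.assoc)
      then show ?thesis by (simp only: FLX)
    qed
    then have "{t. det (transpose ((S + t *\<^sub>R (F ** L)) ** X) ** ((S + t *\<^sub>R (F ** L)) ** X)) = 0}
       = {t. \<not> inj ((*v) (S ** X + t *\<^sub>R F))}"
      using det_gram_nonzero_iff by (metis (no_types, lifting))
    then show "countable {t. det (transpose ((S + t *\<^sub>R (F ** L)) ** X) ** ((S + t *\<^sub>R (F ** L)) ** X)) = 0}"
      using finite_singular_on_line[OF F] by (simp add: countable_finite)
  qed
qed

section \<open>Sketched residuals\<close>

text \<open>Needed because the entries of the sketch are indexed by pairs (i, j), whereas the
  coordinates of a Euclidean space are indexed by \<open>Basis\<close>.\<close>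

lemma prob_space_indep_vars_reindex:
  assumes M: "prob_space M" and f: "inj_on f I"
    and ind: "prob_space.indep_vars M (\<lambda>_. N) X (f ` I)"
  shows "prob_space.indep_vars M (\<lambda>_. N) (\<lambda>i. X (f i)) I"
proof -
  interpret prob_space M by fact
  have "indep_sets (\<lambda>i. {X (f i) -` A \<inter> space M | A. A \<in> sets N}) I"
  proof (rule indep_setsI)
    show "{X (f i) -` A \<inter> space M | A. A \<in> sets N} \<subseteq> events" if "i \<in> I" for i
      using ind that by (auto simp: indep_vars_def2 intro: measurable_sets)
    fix A J assume J: "J \<noteq> {}" "J \<subseteq> I" "finite J"
      and A: "\<forall>j\<in>J. A j \<in> {X (f j) -` A \<inter> space M | A. A \<in> sets N}"
    have inj: "inj_on f J" using f J(2) by (rule inj_on_subset)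
    have inv: "inv_into J f (f j) = j" if "j \<in> J" for j
      using inj that by simp
    have "indep_sets (\<lambda>i. {X i -` A \<inter> space M | A. A \<in> sets N}) (f ` I)"
      using ind by (simp add: indep_vars_def2)
    then have "prob (\<Inter>i\<in>f ` J. A (inv_into J f i)) = (\<Prod>i\<in>f ` J. prob (A (inv_into J f i)))"
      by (rule indep_setsD) (use J A inv in auto)
    then show "prob (\<Inter>j\<in>J. A j) = (\<Prod>j\<in>J. prob (A j))"
      using inj by (simp add: prod.reindex image_image inv cong: prod.cong INF_cong)
  qed
  then show ?thesis
    using ind by (auto simp: indep_vars_def2)
qed

lemma distr_gaussian_sketch:
  fixes S :: "'a \<Rightarrow> real ^ 'n ^ 'k"
  assumes M: "prob_space M" and S: "gaussian_sketch M S"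
  shows "S \<in> borel_measurable M" "distr M borel S = gauss (1 / sqrt (real CARD('k)))"
proof -
  interpret prob_space M by fact
  have ind: "indep_vars (\<lambda>_. borel) (\<lambda>(i, j) \<omega>. S \<omega> $ i $ j) UNIV"
    and D: "\<And>i j. distributed M lborel (\<lambda>\<omega>. S \<omega> $ i $ j)
              (\<lambda>x. ennreal (normal_density 0 (1 / sqrt (real CARD('k))) x))"
    using S by (auto simp: gaussian_sketch_def)
  define f where "f b = (SOME (i, j). b = axis i (axis j (1::real)))" for b :: "real ^ 'n ^ 'k"
  have f: "b = axis (fst (f b)) (axis (snd (f b)) 1)" if "b \<in> Basis" for b
  proof -
    have "\<exists>p. case p of (i, j) \<Rightarrow> b = axis i (axis j (1::real))"
      using that by (auto simp: Basis_vec_def)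
    from someI_ex[OF this] show ?thesis by (simp add: f_def case_prod_unfold)
  qed
  have inj: "inj_on f Basis"
    by (intro inj_onI) (metis f)
  have comp: "S \<omega> \<bullet> b = S \<omega> $ fst (f b) $ snd (f b)" if "b \<in> Basis" for b \<omega>
    by (subst f[OF that]) (simp add: inner_axis)
  have "indep_vars (\<lambda>_. borel) (\<lambda>b. (\<lambda>(i, j) \<omega>. S \<omega> $ i $ j) (f b)) Basis"
    by (rule prob_space_indep_vars_reindex[OF M inj]) (rule indep_vars_subset[OF ind], simp)
  then have "indep_vars (\<lambda>_. borel) (\<lambda>b \<omega>. S \<omega> \<bullet> b) Basis"
    by (subst indep_vars_cong[OF refl _ refl]) (auto simp: comp case_prod_unfold)
  then show "distr M borel S = gauss (1 / sqrt (real CARD('k)))"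
    by (rule distr_eq_gauss[rotated]) (use D in \<open>auto simp: comp\<close>)
  have [measurable]: "(\<lambda>\<omega>. S \<omega> $ i $ j) \<in> borel_measurable M" for i j
    using D[of i j] by (auto simp: distributed_def)
  show "S \<in> borel_measurable M"
    by (subst borel_measurable_euclidean_space) (auto simp: comp)
qed

lemma distr_mvn_scaled_identity:
  fixes y :: "'a \<Rightarrow> real ^ 'n"
  assumes s: "\<sigma> > 0"
    and y: "distributed M lborel y (\<lambda>v. ennreal (mvn_density \<mu> (\<sigma>\<^sup>2 *\<^sub>R mat 1) v))"
  shows "distr M borel (\<lambda>\<omega>. y \<omega> - \<mu>) = gauss \<sigma>"
proof -
  let ?A = "\<sigma>\<^sup>2 *\<^sub>R mat 1 :: real ^ 'n ^ 'n"
  have [measurable]: "y \<in> borel_measurable M"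
    using y by (auto simp: distributed_def)
  have det: "det ?A = (\<sigma>\<^sup>2) ^ CARD('n)"
    by (subst det_diagonal) (simp_all add: mat_def)
  then have "?A ** matrix_inv ?A = mat 1"
    using s by (intro matrix_mul_matrix_inv) simp
  then have "\<sigma>\<^sup>2 *\<^sub>R matrix_inv ?A = mat 1"
    by (simp flip: scalar_matrix_assoc)
  then have "(1 / \<sigma>\<^sup>2) *\<^sub>R (\<sigma>\<^sup>2 *\<^sub>R matrix_inv ?A) = (1 / \<sigma>\<^sup>2) *\<^sub>R mat 1"
    by (simp only:)
  then have inv: "matrix_inv ?A = (1 / \<sigma>\<^sup>2) *\<^sub>R mat 1"
    unfolding scaleR_scaleR using s by simp
  have mvn: "mvn_density \<mu> ?A (\<mu> + v) = (\<Prod>b\<in>Basis. normal_density 0 \<sigma> (v \<bullet> b))" for v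
  proof -
    have "v \<bullet> (matrix_inv ?A *v v) = (norm v)\<^sup>2 / \<sigma>\<^sup>2"
      by (simp add: inv power2_norm_eq_inner flip: scaleR_matrix_vector_assoc)
    moreover have "sqrt ((2 * pi) ^ CARD('n) * det ?A) = sqrt (2 * pi * \<sigma>\<^sup>2) ^ CARD('n)"
      by (simp only: det power_mult_distrib[symmetric] real_sqrt_power)
    ultimately show ?thesis
      unfolding mvn_density_def prod_normal_density by (simp add: mult.commute)
  qed
  have [measurable]: "(\<lambda>v. ennreal (mvn_density \<mu> ?A v)) \<in> borel_measurable borel"
    using y by (auto simp: distributed_def)
  have "distr M borel (\<lambda>\<omega>. y \<omega> - \<mu>) = distr (distr M lborel y) borel (\<lambda>v. v - \<mu>)"
    by (subst distr_distr) (auto simp: comp_def)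
  also have "distr M lborel y = density lborel (\<lambda>v. ennreal (mvn_density \<mu> ?A v))"
    using y by (simp add: distributed_def)
  \<comment> \<open>Lebesgue measure is written as its own translate by \<mu>, which exhibits the
    law as a centred Gaussian moved by \<mu>.\<close>
  also have "\<dots> = density (distr lborel borel ((+) \<mu>)) (\<lambda>v. ennreal (mvn_density \<mu> ?A v))"
    by (simp add: lborel_distr_plus)
  also have "\<dots> = distr (gauss \<sigma>) borel ((+) \<mu>)"
    by (subst density_distr) (simp_all add: mvn gauss_def)
  also have "distr \<dots> borel (\<lambda>v. v - \<mu>) = gauss \<sigma>"
    by (subst distr_distr) (auto simp: comp_def distr_id2)
  finally show ?thesis .
qed

section \<open>Chi-square laws of residual sums of squares\<close>

lemma gauss_real: "gauss s = density lborel (\<lambda>x. ennreal (normal_density 0 s x))"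
  by (simp add: gauss_def)

text \<open>Induction on B. The resampling identity with A g = g u and B z = z \<bullet> u replaces
  the coordinate along a new vector u by a fresh normal g; the other coordinates, being orthogonal
  to u, are untouched. The sum of squares thus gains an independent chi-square term with one degree
  of freedom.\<close>

lemma distr_gauss_sum_squares:
  fixes B :: "'a::euclidean_space set"
  assumes s: "s > 0" and B: "finite B" "B \<noteq> {}" "pairwise orthogonal B" "\<And>b. b \<in> B \<Longrightarrow> norm b = 1"
  shows "distr (gauss s) borel (\<lambda>z. (\<Sum>b\<in>B. (z \<bullet> b)\<^sup>2) / s\<^sup>2) = chi_square (real (card B))"
proof -
  interpret g: prob_space "gauss s :: 'a measure" by (rule prob_space_gauss[OF s])
  have step: "(\<integral>\<^sup>+z. f ((\<Sum>b\<in>insert u F. (z \<bullet> b)\<^sup>2) / s\<^sup>2) \<partial>gauss s)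
      = (\<integral>\<^sup>+z. \<integral>\<^sup>+q. f ((\<Sum>b\<in>F. (z \<bullet> b)\<^sup>2) / s\<^sup>2 + q) \<partial>chi_square 1 \<partial>gauss s)"
    if F: "finite F" "u \<notin> F" and u: "norm u = 1" and orth: "\<And>b. b \<in> F \<Longrightarrow> u \<bullet> b = 0"
      and [measurable]: "f \<in> borel_measurable borel" for u :: 'a and F and f :: "real \<Rightarrow> ennreal"
  proof -
    have uu: "u \<bullet> u = 1" using u by (simp add: norm_eq_1)
    have "(\<integral>\<^sup>+z. f ((\<Sum>b\<in>insert u F. (z \<bullet> b)\<^sup>2) / s\<^sup>2) \<partial>gauss s)
      = (\<integral>\<^sup>+z. \<integral>\<^sup>+g. f ((\<Sum>b\<in>insert u F. ((z - (z \<bullet> u) *\<^sub>R u + g *\<^sub>R u) \<bullet> b)\<^sup>2) / s\<^sup>2) \<partial>gauss s \<partial>gauss s)"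
    proof (rule nn_integral_gauss_swap[symmetric, OF s, where A = "\<lambda>g. g *\<^sub>R u" and B = "\<lambda>z. z \<bullet> u"
          and f = "\<lambda>z. f ((\<Sum>b\<in>insert u F. (z \<bullet> b)\<^sup>2) / s\<^sup>2)"])
      show "linear (\<lambda>g. g *\<^sub>R u)" "linear (\<lambda>z. z \<bullet> u)"
        by (rule bounded_linear.linear, rule bounded_linear_scaleR_left bounded_linear_inner_left)+
      show "(g *\<^sub>R u) \<bullet> z = g \<bullet> (z \<bullet> u)" for g z
        by (simp add: inner_commute[of u])
      show "(g *\<^sub>R u) \<bullet> u = g" for g
        by (simp add: uu)
    qed measurable
    also have "\<dots> = (\<integral>\<^sup>+z. \<integral>\<^sup>+g. f ((\<Sum>b\<in>F. (z \<bullet> b)\<^sup>2) / s\<^sup>2 + g\<^sup>2 / s\<^sup>2) \<partial>gauss s \<partial>gauss s)"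
    proof -
      have "(\<Sum>b\<in>insert u F. ((z - (z \<bullet> u) *\<^sub>R u + g *\<^sub>R u) \<bullet> b)\<^sup>2) = (\<Sum>b\<in>F. (z \<bullet> b)\<^sup>2) + g\<^sup>2" for z g
      proof -
        have "(\<Sum>b\<in>F. ((z - (z \<bullet> u) *\<^sub>R u + g *\<^sub>R u) \<bullet> b)\<^sup>2) = (\<Sum>b\<in>F. (z \<bullet> b)\<^sup>2)"
          by (intro sum.cong refl) (simp add: inner_add_left inner_diff_left orth)
        then show ?thesis
          using F by (simp add: inner_add_left inner_diff_left uu)
      qed
      then show ?thesis by (simp add: add_divide_distrib)
    qed
    also have "\<dots> = (\<integral>\<^sup>+z. \<integral>\<^sup>+q. f ((\<Sum>b\<in>F. (z \<bullet> b)\<^sup>2) / s\<^sup>2 + q) \<partial>chi_square 1 \<partial>gauss s)"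
      by (simp add: distr_normal_square[OF s, symmetric] gauss_real nn_integral_distr)
    finally show ?thesis .
  qed
  show ?thesis
    using B
  proof (induction B rule: finite_ne_induct)
    \<comment> \<open>The induction starts at one vector: \<open>Gamma 0\<close> is 0, so
      \<open>chi_square 0\<close> is the zero measure and not the point mass at 0 that an empty sum
      would have.\<close>
    case (singleton u)
    show ?case
    proof (rule measure_eqI)
      fix A assume "A \<in> sets (distr (gauss s) borel (\<lambda>z. (\<Sum>b\<in>{u}. (z \<bullet> b)\<^sup>2) / s\<^sup>2))"
      then have [measurable]: "A \<in> sets borel" by simp
      have "emeasure (distr (gauss s) borel (\<lambda>z. (\<Sum>b\<in>{u}. (z \<bullet> b)\<^sup>2) / s\<^sup>2)) A
        = (\<integral>\<^sup>+z. indicator A ((\<Sum>b\<in>{u}. (z \<bullet> b)\<^sup>2) / s\<^sup>2) \<partial>gauss s)"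
        by (rule emeasure_distr_nn_integral) simp_all
      also have "\<dots> = emeasure (chi_square 1) A"
        using step[of "{}" u "indicator A"] singleton by (simp add: g.emeasure_space_1[simplified])
      finally show "emeasure (distr (gauss s) borel (\<lambda>z. (\<Sum>b\<in>{u}. (z \<bullet> b)\<^sup>2) / s\<^sup>2)) A
        = emeasure (chi_square (real (card {u}))) A" by simp
    qed simp
  next
    case (insert u F)
    have IH: "distr (gauss s) borel (\<lambda>z. (\<Sum>b\<in>F. (z \<bullet> b)\<^sup>2) / s\<^sup>2) = chi_square (real (card F))"
      using insert by (intro insert.IH) (auto simp: pairwise_insert)
    have F: "card F > 0" using insert by (simp add: card_gt_0_iff)
    have orth: "u \<bullet> b = 0" if "b \<in> F" for b
      using insert that by (auto simp: pairwise_insert orthogonal_def)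
    show ?case
    proof (rule measure_eqI)
      fix A assume "A \<in> sets (distr (gauss s) borel (\<lambda>z. (\<Sum>b\<in>insert u F. (z \<bullet> b)\<^sup>2) / s\<^sup>2))"
      then have [measurable]: "A \<in> sets borel" by simp
      interpret c1: prob_space "chi_square 1" by (rule prob_space_chi_square) simp
      interpret cF: prob_space "chi_square (real (card F))" by (rule prob_space_chi_square) (simp add: F)
      have "emeasure (distr (gauss s) borel (\<lambda>z. (\<Sum>b\<in>insert u F. (z \<bullet> b)\<^sup>2) / s\<^sup>2)) A
        = (\<integral>\<^sup>+z. indicator A ((\<Sum>b\<in>insert u F. (z \<bullet> b)\<^sup>2) / s\<^sup>2) \<partial>gauss s)"
        by (rule emeasure_distr_nn_integral) simp_all
      also have "\<dots> = (\<integral>\<^sup>+z. \<integral>\<^sup>+q. indicator A ((\<Sum>b\<in>F. (z \<bullet> b)\<^sup>2) / s\<^sup>2 + q) \<partial>chi_square 1 \<partial>gauss s)"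
        using insert orth by (intro step) auto
      also have "\<dots> = (\<integral>\<^sup>+t. \<integral>\<^sup>+q. indicator A (t + q) \<partial>chi_square 1 \<partial>chi_square (real (card F)))"
        unfolding IH[symmetric] by (subst nn_integral_distr) simp_all
      also have "\<dots> = (\<integral>\<^sup>+t. indicator A t \<partial>(chi_square (real (card F)) \<star> chi_square 1))"
        by (rule nn_integral_convolution[symmetric]) (simp_all add: c1.finite_measure_axioms cF.finite_measure_axioms)
      also have "\<dots> = emeasure (chi_square (real (card (insert u F)))) A"
        using insert F by (subst chi_square_convolution) (simp_all add: add.commute)
      finally show "emeasure (distr (gauss s) borel (\<lambda>z. (\<Sum>b\<in>insert u F. (z \<bullet> b)\<^sup>2) / s\<^sup>2)) A
        = emeasure (chi_square (real (card (insert u F)))) A" .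
    qed simp
  qed
qed

text \<open>Used with W = X and the noise in the response, which gives the law of SSR_F, and with W
  = S X for a frozen S and the fresh Gaussian replacing S u.\<close>

lemma distr_gauss_SSR:
  fixes W :: "real ^ 'p ^ 'm"
  assumes s: "s > 0" and W: "det (transpose W ** W) \<noteq> 0" and card: "CARD('p) < CARD('m)"
  shows "distr (gauss s) borel (\<lambda>z. SSR W z / s\<^sup>2) = chi_square (real CARD('m) - real CARD('p))"
proof -
  obtain B where B: "finite B" "pairwise orthogonal B" "\<And>b. b \<in> B \<Longrightarrow> norm b = 1"
    "card B + CARD('p) = CARD('m)" "\<And>v. SSR W v = (\<Sum>b\<in>B. (v \<bullet> b)\<^sup>2)"
    using SSR_eq_sum_orthonormal[OF W] by metis
  have "real (card B) = real CARD('m) - real CARD('p)" "B \<noteq> {}"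
    using B(4) card by auto
  then show ?thesis
    using distr_gauss_sum_squares[OF s B(1) _ B(2,3)] by (simp add: B(5))
qed

text \<open>Write \<open>y = r + X b\<close> with \<open>r\<close> orthogonal to the columns of \<open>X\<close>, and \<open>u = r / |r|\<close>. Resampling \<open>S u\<close>
  as an independent \<open>g\<close> changes neither the law of \<open>S\<close> nor \<open>S X\<close>, but turns \<open>S r\<close> into \<open>|r| g\<close>.\<close>

lemma distr_sketch_SSR_ratio:
  fixes X :: "real ^ 'p ^ 'n" and y :: "real ^ 'n"
  assumes s: "s > 0" and X: "det (transpose X ** X) \<noteq> 0" and card: "CARD('p) < CARD('k)"
    and y: "SSR X y \<noteq> 0"
  shows "distr (gauss s :: (real ^ 'n ^ 'k) measure) borel (\<lambda>S. SSR (S ** X) (S *v y) / (SSR X y * s\<^sup>2))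
    = chi_square (real CARD('k) - real CARD('p))"
proof (rule measure_eqI)
  fix C assume "C \<in> sets (distr (gauss s :: (real ^ 'n ^ 'k) measure) borel (\<lambda>S. SSR (S ** X) (S *v y) / (SSR X y * s\<^sup>2)))"
  then have C [measurable]: "C \<in> sets borel" by simp
  interpret gS: prob_space "gauss s :: (real ^ 'n ^ 'k) measure" by (rule prob_space_gauss[OF s])
  obtain r b where r: "y = r + X *v b" "transpose X *v r = 0" "SSR X y = (norm r)\<^sup>2"
    using residual_decomposition[OF X] .
  define u where "u = r /\<^sub>R norm r"
  have nr: "norm r \<noteq> 0" using y r(3) by auto
  then have ru: "r = norm r *\<^sub>R u" and "norm u = 1"
    by (auto simp: u_def)
  then have uu: "u \<bullet> u = 1" by (simp add: norm_eq_1)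
  have uX: "(\<Sum>j\<in>UNIV. u $ j * X $ j $ l) = 0" for l
  proof -
    have "transpose X *v u = 0" unfolding u_def using r(2) by (simp add: matrix_vector_mult_scaleR)
    then have "(transpose X *v u) $ l = 0" by (simp only: zero_index)
    then show ?thesis by (simp add: matrix_vector_mult_def transpose_def mult.commute del: transpose_matrix_vector)
  qed
  \<comment> \<open>A g is the rank one matrix g u^T. It is adjoint to S \<mapsto> S u for the
    entrywise inner product, and (A g) X = 0 because u is orthogonal to the columns of X.\<close>
  define A :: "real ^ 'k \<Rightarrow> real ^ 'n ^ 'k" where "A g = (\<chi> i j. g $ i * u $ j)" for g
  define B :: "real ^ 'n ^ 'k \<Rightarrow> real ^ 'k" where "B S = S *v u" for S
  have lin: "linear A" "linear B"
    by (auto simp: linear_iff A_def B_def vec_eq_iff matrix_vector_mult_def distrib_right sum.distrib sum_distrib_left mult.assoc)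
  have BA: "B (A g) = g" for g
    using uu by (simp add: A_def B_def vec_eq_iff matrix_vector_mult_def mult.assoc inner_vec_def flip: sum_distrib_left)
  have adj: "A g \<bullet> S = g \<bullet> B S" for g S
    by (simp add: A_def B_def inner_vec_def matrix_vector_mult_def sum_distrib_left mult_ac)
  have AX: "A g ** X = 0" for g
    using uX by (simp add: A_def vec_eq_iff matrix_matrix_mult_def mult.assoc flip: sum_distrib_left)
  have addX: "(P + Q) ** X = P ** X + Q ** X" "(P - Q) ** X = P ** X - Q ** X" for P Q :: "real ^ 'n ^ 'k"
    by (auto simp: matrix_matrix_mult_def vec_eq_iff distrib_right left_diff_distrib sum.distrib sum_subtractf)
  let ?Q = "\<lambda>S :: real ^ 'n ^ 'k. SSR (S ** X) (S *v y) / (SSR X y * s\<^sup>2)"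
  let ?\<gamma> = "gauss s :: (real ^ 'n ^ 'k) measure"
  have "AE S in lborel. det (transpose ((S :: real ^ 'n ^ 'k) ** X) ** (S ** X)) \<noteq> 0"
    using X card by (intro AE_sketch_full_rank) (simp_all add: det_gram_nonzero_iff)
  then have AE: "AE S in ?\<gamma>. det (transpose (S ** X) ** (S ** X)) \<noteq> 0"
    unfolding gauss_def by (subst AE_density) (auto elim: eventually_mono)
  \<comment> \<open>After the swap, S y becomes |r| g + (S X) b. The second term does not affect
    \<open>SSR\<close> at full rank, and |r|^2 cancels against SSR_F.\<close>
  have Q: "?Q (S - A (B S) + A g) = SSR (S ** X) g / s\<^sup>2"
    if S: "det (transpose (S ** X) ** (S ** X)) \<noteq> 0" for S g
  proof -
    let ?S' = "S - A (B S) + A g"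
    have SX: "?S' ** X = S ** X" by (simp add: addX AX)
    have "?S' *v u = g"
      using BA lin(2) by (simp add: linear_add linear_diff flip: B_def)
    then have Sr: "?S' *v r = norm r *\<^sub>R g"
      by (subst ru) (simp add: matrix_vector_mult_scaleR)
    have "?S' *v y = norm r *\<^sub>R g + (S ** X) *v b"
      by (simp only: r(1) matrix_vector_right_distrib matrix_vector_mul_assoc Sr SX)
    then have "SSR (?S' ** X) (?S' *v y) = (norm r)\<^sup>2 * SSR (S ** X) g"
      unfolding SX by (simp only: SSR_add_column_space[OF S] SSR_scaleR)
    then show ?thesis using nr by (simp add: r(3))
  qed
  have "emeasure (distr ?\<gamma> borel ?Q) C = (\<integral>\<^sup>+S. indicator C (?Q S) \<partial>?\<gamma>)"
    by (rule emeasure_distr_nn_integral) simp_all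
  also have "\<dots> = (\<integral>\<^sup>+S. \<integral>\<^sup>+g. indicator C (?Q (S - A (B S) + A g)) \<partial>gauss s \<partial>?\<gamma>)"
    by (rule nn_integral_gauss_swap[symmetric, OF s lin adj BA]) measurable
  \<comment> \<open>With S frozen, S X is a fixed matrix of full rank, and the law of the inner
    expression in g is the same for almost every S.\<close>
  also have "\<dots> = (\<integral>\<^sup>+S. emeasure (chi_square (real CARD('k) - real CARD('p))) C \<partial>?\<gamma>)"
    using AE
  proof (intro nn_integral_cong_AE, eventually_elim)
    fix S :: "real ^ 'n ^ 'k" assume S: "det (transpose (S ** X) ** (S ** X)) \<noteq> 0"
    have "(\<integral>\<^sup>+g. indicator C (?Q (S - A (B S) + A g)) \<partial>gauss s) = (\<integral>\<^sup>+g. indicator C (SSR (S ** X) g / s\<^sup>2) \<partial>gauss s)"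
      by (simp only: Q[OF S])
    also have "\<dots> = emeasure (distr (gauss s) borel (\<lambda>g. SSR (S ** X) g / s\<^sup>2)) C"
      by (rule emeasure_distr_nn_integral[symmetric]) simp_all
    also have "\<dots> = emeasure (chi_square (real CARD('k) - real CARD('p))) C"
      by (simp only: distr_gauss_SSR[OF s S card])
    finally show "(\<integral>\<^sup>+g. indicator C (?Q (S - A (B S) + A g)) \<partial>gauss s)
      = emeasure (chi_square (real CARD('k) - real CARD('p))) C" .
  qed
  also have "\<dots> = emeasure (chi_square (real CARD('k) - real CARD('p))) C"
    by (simp add: gS.emeasure_space_1[simplified])
  finally show "emeasure (distr ?\<gamma> borel ?Q) C = emeasure (chi_square (real CARD('k) - real CARD('p))) C" .
qed simp

text \<open>S and y take values in different types, so their independence is given through the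
  generated sigma-algebras. On rectangles it is the product formula, and rectangles determine the
  product measure.\<close>

lemma (in prob_space) distr_Pair_eq_pair_measure:
  assumes [measurable]: "X \<in> M \<rightarrow>\<^sub>M N" "Y \<in> M \<rightarrow>\<^sub>M L"
    and ind: "indep_set (sets (vimage_algebra (space M) X N)) (sets (vimage_algebra (space M) Y L))"
  shows "distr M (N \<Otimes>\<^sub>M L) (\<lambda>\<omega>. (X \<omega>, Y \<omega>)) = distr M N X \<Otimes>\<^sub>M distr M L Y"
proof -
  interpret X: prob_space "distr M N X" by (rule prob_space_distr) measurable
  interpret Y: prob_space "distr M L Y" by (rule prob_space_distr) measurable
  show ?thesis
  proof (rule pair_measure_eqI[symmetric])
    fix A B assume "A \<in> sets (distr M N X)" "B \<in> sets (distr M L Y)"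
    then have [measurable]: "A \<in> sets N" "B \<in> sets L" by simp_all
    have "prob ((X -` A \<inter> space M) \<inter> (Y -` B \<inter> space M)) = prob (X -` A \<inter> space M) * prob (Y -` B \<inter> space M)"
      by (rule indep_setD[OF ind]) (auto intro: in_vimage_algebra)
    moreover have "(X -` A \<inter> space M) \<inter> (Y -` B \<inter> space M) = (\<lambda>\<omega>. (X \<omega>, Y \<omega>)) -` (A \<times> B) \<inter> space M"
      by auto
    ultimately show "emeasure (distr M N X) A * emeasure (distr M L Y) B
      = emeasure (distr M (N \<Otimes>\<^sub>M L) (\<lambda>\<omega>. (X \<omega>, Y \<omega>))) (A \<times> B)"
      by (simp add: emeasure_distr emeasure_eq_measure ennreal_mult[symmetric])
  qed (simp_all add: X.sigma_finite_measure_axioms Y.sigma_finite_measure_axioms)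
qed

text \<open>The density h is claimed for \<open>SSR\<^sub>s / (\<sigma>\<^sup>2 / k)\<close>. Being
  the density of a product of independent chi-square variables, h has mean (k - p)(n - p), whereas
  SSR_s / \<sigma>^2 has mean (k - p)(n - p) / k; the factor k therefore belongs to the
  scaling.\<close>

theorem mainTheorem3:
  fixes M :: "'a measure"
    and X :: "real ^ 'p ^ 'n" and \<beta>\<^sub>0 :: "real ^ 'p" and \<sigma> :: real
    and y :: "'a \<Rightarrow> real ^ 'n" and S :: "'a \<Rightarrow> real ^ 'n ^ 'k"
    and n p k :: nat and SSR\<^sub>F SSR\<^sub>s :: "'a \<Rightarrow> real"
  assumes "prob_space M"
    and "n = CARD('n)" and "p = CARD('p)" and "k = CARD('k)"
    and "rank X = p" and "p < n" and "p < k" and "\<sigma> > 0"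
    and "distributed M lborel y (\<lambda>v. ennreal (mvn_density (X *v \<beta>\<^sub>0) (\<sigma>\<^sup>2 *\<^sub>R mat 1) v))"
    and "gaussian_sketch M S"
    and "prob_space.indep_set M
           (sets (vimage_algebra (space M) S borel)) (sets (vimage_algebra (space M) y borel))"
    and SSR\<^sub>F: "SSR\<^sub>F = (\<lambda>\<omega>. SSR X (y \<omega>))"
    and SSR\<^sub>s: "SSR\<^sub>s = (\<lambda>\<omega>. SSR (S \<omega> ** X) (S \<omega> *v y \<omega>))"
  shows "has_cond_distribution M (\<lambda>\<omega>. SSR\<^sub>s \<omega> / (SSR\<^sub>F \<omega> / real k)) SSR\<^sub>F
           (\<lambda>_. chi_square (real k - real p))
    \<and> distributed M lborel (\<lambda>\<omega>. SSR\<^sub>F \<omega> / \<sigma>\<^sup>2)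
        (\<lambda>u. ennreal (chi_square_density (real n - real p) u))
    \<and> integrable M SSR\<^sub>s
    \<and> prob_space.expectation M SSR\<^sub>s = \<sigma>\<^sup>2 * ((real k - real p) * (real n - real p) / real k)
    \<and> prob_space.expectation M
        (\<lambda>\<omega>. SSR\<^sub>s \<omega> * (real k / ((real n - real p) * (real k - real p)))) = \<sigma>\<^sup>2
    \<and> distributed M lborel (\<lambda>\<omega>. SSR\<^sub>s \<omega> / (\<sigma>\<^sup>2 / real k))
        (\<lambda>u. ennreal (if u > 0 then
            u powr ((real n + real k - 2 * real p) / 4 - 1)
              * bessel_K ((real k - real n) / 2) (sqrt u)
              / (Gamma ((real k - real p) / 2) * Gamma ((real n - real p) / 2)
                 * 2 powr ((real n - real p) / 2 + (real k - real p) / 2 - 1))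
          else 0))"
proof -
  interpret prob_space M by fact
  define a b where "a = real k - real p" and "b = real n - real p"
  have a: "a > 0" and b: "b > 0" and k: "real k > 0" and s: "1 / sqrt (real k) > 0"
    using \<open>p < k\<close> \<open>p < n\<close> by (auto simp: a_def b_def)
  interpret qa: prob_space "chi_square a" by (rule prob_space_chi_square[OF a])
  interpret qb: prob_space "chi_square b" by (rule prob_space_chi_square[OF b])
  interpret ab: pair_prob_space "chi_square a" "chi_square b" ..
  have X: "det (transpose X ** X) \<noteq> 0"
    using \<open>rank X = p\<close> \<open>p = CARD('p)\<close> by (simp add: det_gram_nonzero_iff full_rank_injective[symmetric])
  have card: "CARD('p) < CARD('k)" using assms by simp
  let ?\<gamma> = "gauss (1 / sqrt (real k)) :: (real ^ 'n ^ 'k) measure"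
  interpret g: prob_space ?\<gamma> by (rule prob_space_gauss[OF s])
  have S [measurable]: "S \<in> borel_measurable M" and distr_S: "distr M borel S = ?\<gamma>"
    using distr_gaussian_sketch[OF \<open>prob_space M\<close> \<open>gaussian_sketch M S\<close>] \<open>k = CARD('k)\<close> by simp_all
  have y [measurable]: "y \<in> borel_measurable M"
    using assms(9) by (auto simp: distributed_def)
  define Q where "Q = (\<lambda>\<omega>. SSR\<^sub>s \<omega> / (SSR\<^sub>F \<omega> / real k))"
  define V where "V = (\<lambda>\<omega>. SSR\<^sub>F \<omega> / \<sigma>\<^sup>2)"
  have [measurable]: "SSR\<^sub>F \<in> borel_measurable M" "SSR\<^sub>s \<in> borel_measurable M"
    unfolding SSR\<^sub>F SSR\<^sub>s by measurable
  have [measurable]: "Q \<in> borel_measurable M" "V \<in> borel_measurable M"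
    unfolding Q_def V_def by measurable

  have distr_V: "distr M borel V = chi_square b"
  proof -
    \<comment> \<open>The mean lies in the column space of X, so V depends on the noise
      alone.\<close>
    have "V \<omega> = SSR X (y \<omega> - X *v \<beta>\<^sub>0) / \<sigma>\<^sup>2" for \<omega>
      using SSR_add_column_space[OF X, of "y \<omega> - X *v \<beta>\<^sub>0" "\<beta>\<^sub>0"] by (simp add: V_def SSR\<^sub>F)
    then have "distr M borel V = distr (distr M borel (\<lambda>\<omega>. y \<omega> - X *v \<beta>\<^sub>0)) borel (\<lambda>z. SSR X z / \<sigma>\<^sup>2)"
      by (subst distr_distr) (auto simp: comp_def intro!: distr_cong)
    also have "\<dots> = chi_square b"
      unfolding distr_mvn_scaled_identity[OF \<open>\<sigma> > 0\<close> assms(9)]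
      using distr_gauss_SSR[OF \<open>\<sigma> > 0\<close> X] assms by (simp add: b_def)
    finally show ?thesis .
  qed

  have chi_pos: "AE u in chi_square \<nu>. u > 0" for \<nu>
    unfolding chi_square_def by (subst AE_density) (auto simp: chi_square_density_def)
  \<comment> \<open>Where SSR_F = 0, division by zero would make Q equal to 0, and U = Q V could
    fail.\<close>
  have "AE v in distr M borel V. v > 0" unfolding distr_V by (rule chi_pos)
  then have V_pos: "AE \<omega> in M. V \<omega> > 0"
    by (subst (asm) AE_distr_iff) auto

  have joint: "distr M (borel \<Otimes>\<^sub>M borel) (\<lambda>\<omega>. (S \<omega>, y \<omega>)) = ?\<gamma> \<Otimes>\<^sub>M distr M borel y"
    using distr_Pair_eq_pair_measure[OF S y assms(11)] by (simp only: distr_S)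
  interpret dy: prob_space "distr M borel y" by (rule prob_space_distr) measurable
  interpret gy: pair_prob_space ?\<gamma> "distr M borel y" ..

  \<comment> \<open>The joint law of Q and V in integral form. The density, the expectation,
    positivity and the conditional law are all instances of it for suitable f.\<close>
  have QV: "(\<integral>\<^sup>+\<omega>. f (Q \<omega>) (V \<omega>) \<partial>M) = (\<integral>\<^sup>+v. \<integral>\<^sup>+q. f q v \<partial>chi_square a \<partial>chi_square b)"
    if f [measurable]: "(\<lambda>(q, v). f q v) \<in> borel_measurable (borel \<Otimes>\<^sub>M borel)" for f :: "real \<Rightarrow> real \<Rightarrow> ennreal"
  proof -
    let ?q = "\<lambda>S v. SSR (S ** X) (S *v v) / (SSR X v / real k)"
    have "(\<integral>\<^sup>+\<omega>. f (Q \<omega>) (V \<omega>) \<partial>M)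
        = (\<integral>\<^sup>+w. f (?q (fst w) (snd w)) (SSR X (snd w) / \<sigma>\<^sup>2) \<partial>distr M (borel \<Otimes>\<^sub>M borel) (\<lambda>\<omega>. (S \<omega>, y \<omega>)))"
      by (subst nn_integral_distr) (simp_all add: Q_def V_def SSR\<^sub>F SSR\<^sub>s)
    also have "\<dots> = (\<integral>\<^sup>+v. \<integral>\<^sup>+S. f (?q S v) (SSR X v / \<sigma>\<^sup>2) \<partial>?\<gamma> \<partial>distr M borel y)"
      unfolding joint by (subst gy.nn_integral_snd[symmetric]) simp_all
    also have "\<dots> = (\<integral>\<^sup>+\<omega>. \<integral>\<^sup>+S. f (?q S (y \<omega>)) (V \<omega>) \<partial>?\<gamma> \<partial>M)"
      by (subst nn_integral_distr) (simp_all add: V_def SSR\<^sub>F)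
    also have "\<dots> = (\<integral>\<^sup>+\<omega>. \<integral>\<^sup>+q. f q (V \<omega>) \<partial>chi_square a \<partial>M)"
      using V_pos
    proof (intro nn_integral_cong_AE, eventually_elim)
      fix \<omega> assume "V \<omega> > 0"
      then have nz: "SSR X (y \<omega>) \<noteq> 0" by (auto simp: V_def SSR\<^sub>F)
      \<comment> \<open>The sketch entries have variance s^2 = 1 / k; this is the k in the
        denominator SSR_F / k.\<close>
      have eq: "SSR (S ** X) (S *v y \<omega>) / (SSR X (y \<omega>) * (1 / sqrt (real k))\<^sup>2) = ?q S (y \<omega>)" for S :: "real ^ 'n ^ 'k"
        by (simp add: power_divide)
      have chi: "chi_square a = distr ?\<gamma> borel (\<lambda>S. ?q S (y \<omega>))"
        using distr_sketch_SSR_ratio[OF s X card nz, unfolded eq] \<open>p = CARD('p)\<close> \<open>k = CARD('k)\<close>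
        by (simp add: a_def)
      show "(\<integral>\<^sup>+S. f (?q S (y \<omega>)) (V \<omega>) \<partial>?\<gamma>) = (\<integral>\<^sup>+q. f q (V \<omega>) \<partial>chi_square a)"
        unfolding chi by (subst nn_integral_distr) simp_all
    qed
    also have "\<dots> = (\<integral>\<^sup>+v. \<integral>\<^sup>+q. f q v \<partial>chi_square a \<partial>chi_square b)"
      unfolding distr_V[symmetric] by (subst nn_integral_distr) simp_all
    finally show ?thesis .
  qed

  define U where "U = (\<lambda>\<omega>. SSR\<^sub>s \<omega> / (\<sigma>\<^sup>2 / real k))"
  have [measurable]: "U \<in> borel_measurable M" unfolding U_def by measurable
  have UQV: "AE \<omega> in M. U \<omega> = Q \<omega> * V \<omega>"
    using V_pos by eventually_elim (use \<open>\<sigma> > 0\<close> k in \<open>auto simp: U_def Q_def V_def field_simps\<close>)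
  have distr_U: "distr M borel U = distr (chi_square a \<Otimes>\<^sub>M chi_square b) borel (\<lambda>(q, v). q * v)"
  proof (rule measure_eqI)
    fix A assume "A \<in> sets (distr M borel U)"
    then have [measurable]: "A \<in> sets borel" by simp
    have "emeasure (distr M borel U) A = (\<integral>\<^sup>+\<omega>. indicator A (U \<omega>) \<partial>M)"
      by (rule emeasure_distr_nn_integral) simp_all
    also have "\<dots> = (\<integral>\<^sup>+\<omega>. indicator A (Q \<omega> * V \<omega>) \<partial>M)"
      using UQV by (intro nn_integral_cong_AE) (auto elim: eventually_mono)
    also have "\<dots> = (\<integral>\<^sup>+v. \<integral>\<^sup>+q. indicator A (q * v) \<partial>chi_square a \<partial>chi_square b)"
      by (rule QV) measurable
    also have "\<dots> = (\<integral>\<^sup>+w. indicator A ((\<lambda>(q, v). q * v) w) \<partial>(chi_square a \<Otimes>\<^sub>M chi_square b))"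
      by (subst ab.nn_integral_snd[symmetric]) simp_all
    also have "\<dots> = emeasure (distr (chi_square a \<Otimes>\<^sub>M chi_square b) borel (\<lambda>(q, v). q * v)) A"
      by (rule emeasure_distr_nn_integral[symmetric]) simp_all
    finally show "emeasure (distr M borel U) A
      = emeasure (distr (chi_square a \<Otimes>\<^sub>M chi_square b) borel (\<lambda>(q, v). q * v)) A" .
  qed simp

  \<comment> \<open>Lets the nonnegative integral of U be read as its expectation. The sign is taken
    from the law of Q, since \<open>SSR\<close> is unspecified where the sketched Gram matrix is
    singular.\<close>
  have U_pos: "AE \<omega> in M. U \<omega> \<ge> 0"
  proof -
    have "(\<integral>\<^sup>+\<omega>. indicator {..0} (Q \<omega>) \<partial>M) = (\<integral>\<^sup>+v. \<integral>\<^sup>+q. indicator {..0} q \<partial>chi_square a \<partial>chi_square b)"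
      by (rule QV) measurable
    also have "(\<integral>\<^sup>+q. indicator {..0} q \<partial>chi_square a) = (\<integral>\<^sup>+q. 0 \<partial>chi_square a)"
      using chi_pos[of a] by (intro nn_integral_cong_AE) (auto elim: eventually_mono)
    finally have "(\<integral>\<^sup>+\<omega>. indicator {..0} (Q \<omega>) \<partial>M) = 0" by simp
    then have "AE \<omega> in M. indicator {..0} (Q \<omega>) = (0 :: ennreal)"
      by (subst (asm) nn_integral_0_iff_AE) simp_all
    then show ?thesis
      using V_pos UQV by eventually_elim (auto simp: indicator_def split: if_splits)
  qed
  have "(\<integral>\<^sup>+\<omega>. ennreal (U \<omega>) \<partial>M) = (\<integral>\<^sup>+\<omega>. ennreal (Q \<omega> * V \<omega>) \<partial>M)"
    using UQV by (intro nn_integral_cong_AE) (auto elim: eventually_mono)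
  also have "\<dots> = (\<integral>\<^sup>+v. \<integral>\<^sup>+q. ennreal (q * v) \<partial>chi_square a \<partial>chi_square b)"
    by (rule QV) measurable
  also have "\<dots> = (\<integral>\<^sup>+v. ennreal a * ennreal v \<partial>chi_square b)"
    using chi_pos[of b]
  proof (intro nn_integral_cong_AE, eventually_elim)
    fix v :: real assume v: "v > 0"
    have "(\<integral>\<^sup>+q. ennreal (q * v) \<partial>chi_square a) = (\<integral>\<^sup>+q. ennreal q * ennreal v \<partial>chi_square a)"
      using v by (simp add: ennreal_mult'')
    then show "(\<integral>\<^sup>+q. ennreal (q * v) \<partial>chi_square a) = ennreal a * ennreal v"
      by (simp add: nn_integral_multc nn_integral_chi_square_ident a)
  qed
  also have "\<dots> = ennreal (a * b)"
    using a b by (simp add: nn_integral_cmult nn_integral_chi_square_ident ennreal_mult)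
  finally have "integrable M U \<and> expectation U = a * b"
    using U_pos a b by (subst (asm) nn_integral_eq_integrable) simp_all
  moreover have SU: "SSR\<^sub>s = (\<lambda>\<omega>. \<sigma>\<^sup>2 / real k * U \<omega>)"
    using \<open>\<sigma> > 0\<close> k by (auto simp: U_def)
  ultimately have int: "integrable M SSR\<^sub>s" and E: "expectation SSR\<^sub>s = \<sigma>\<^sup>2 * (a * b / real k)"
    by simp_all
  have E': "expectation (\<lambda>\<omega>. SSR\<^sub>s \<omega> * (real k / (b * a))) = \<sigma>\<^sup>2"
    using a b k by (simp add: E)

  have distU: "distributed M lborel U (\<lambda>u. ennreal (if u > 0 then
            u powr ((real n + real k - 2 * real p) / 4 - 1)
              * bessel_K ((real k - real n) / 2) (sqrt u)
              / (Gamma (a / 2) * Gamma (b / 2) * 2 powr (b / 2 + a / 2 - 1)) else 0))"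
  proof -
    have eq: "real n + real k - 2 * real p = a + b" "real k - real n = a - b"
      by (simp_all add: a_def b_def)
    have "distr M lborel U = distr M borel U" by (simp cong: distr_cong)
    then show ?thesis
      unfolding eq using distr_U distr_chi_square_mult[OF a b] by (simp add: distributed_def)
  qed

  have distV: "distributed M lborel V (\<lambda>u. ennreal (chi_square_density b u))"
  proof -
    have "distr M lborel V = distr M borel V" by (simp cong: distr_cong)
    then show ?thesis by (simp add: distributed_def distr_V chi_square_def)
  qed

  have cond: "has_cond_distribution M Q SSR\<^sub>F (\<lambda>_. chi_square a)"
    unfolding has_cond_distribution_def
  proof (intro conjI ballI)
    show "(\<lambda>_. chi_square a) \<in> borel \<rightarrow>\<^sub>M prob_algebra borel"
      by (rule measurable_const) (simp add: space_prob_algebra qa.prob_space_axioms)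
    fix A :: "real set" assume A [measurable]: "A \<in> sets borel"
    let ?F = "vimage_algebra (space M) SSR\<^sub>F borel"
    have sub: "subalgebra M ?F"
      by (auto simp: subalgebra_def sets_vimage_algebra2)
    interpret F: finite_measure_subalgebra M ?F
      by standard (rule sub)
    show "AE \<omega> in M. real_cond_exp M ?F (\<lambda>\<omega>. indicator A (Q \<omega>)) \<omega> = measure (chi_square a) A"
    proof (rule F.real_cond_exp_charact)
      show "integrable M (\<lambda>\<omega>. indicator A (Q \<omega>) :: real)"
        by (rule integrable_const_bound[where B = 1]) auto
      \<comment> \<open>It remains to match integrals over an event
        \<open>SSR\<^sub>F \<in> D'\<close>, which is an event in V because SSR_F = \<sigma>^2 V. In
        \<open>QV\<close> the law of q is the same for every v, so the double integral factorises
        into the chi-square measure of A times the probability of D.\<close>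
      fix D assume "D \<in> sets ?F"
      then obtain D' where D' [measurable]: "D' \<in> sets borel" and D: "D = SSR\<^sub>F -` D' \<inter> space M"
        by (auto simp: sets_vimage_algebra2)
      have [measurable]: "D \<in> sets M" unfolding D by measurable
      have F: "SSR\<^sub>F \<omega> = \<sigma>\<^sup>2 * V \<omega>" for \<omega> using \<open>\<sigma> > 0\<close> by (simp add: V_def)
      let ?c = "\<integral>\<^sup>+v. indicator D' (\<sigma>\<^sup>2 * v) \<partial>chi_square b"
      have "(\<integral>\<^sup>+\<omega>. indicator A (Q \<omega>) * indicator D' (\<sigma>\<^sup>2 * V \<omega>) \<partial>M)
          = (\<integral>\<^sup>+v. \<integral>\<^sup>+q. indicator A q * indicator D' (\<sigma>\<^sup>2 * v) \<partial>chi_square a \<partial>chi_square b)"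
        by (rule QV) measurable
      then have 1: "(\<integral>\<^sup>+\<omega>. indicator A (Q \<omega>) * indicator D' (\<sigma>\<^sup>2 * V \<omega>) \<partial>M) = emeasure (chi_square a) A * ?c"
        by (simp add: nn_integral_multc nn_integral_cmult)
      have 2: "(\<integral>\<^sup>+\<omega>. indicator D' (\<sigma>\<^sup>2 * V \<omega>) \<partial>M) = ?c"
        unfolding distr_V[symmetric] by (subst nn_integral_distr) simp_all
      have e1: "emeasure M {\<omega> \<in> space M. Q \<omega> \<in> A \<and> \<omega> \<in> D} = (\<integral>\<^sup>+\<omega>. indicator A (Q \<omega>) * indicator D' (\<sigma>\<^sup>2 * V \<omega>) \<partial>M)"
        by (subst nn_integral_indicator[symmetric], measurable, intro nn_integral_cong)
          (auto simp: indicator_def D F)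
      have e2: "emeasure M D = (\<integral>\<^sup>+\<omega>. indicator D' (\<sigma>\<^sup>2 * V \<omega>) \<partial>M)"
        by (subst nn_integral_indicator[symmetric], measurable, intro nn_integral_cong)
          (auto simp: indicator_def D F)
      have "emeasure M {\<omega> \<in> space M. Q \<omega> \<in> A \<and> \<omega> \<in> D} = emeasure (chi_square a) A * emeasure M D"
        unfolding e1 e2 1 2 ..
      then have "prob {\<omega> \<in> space M. Q \<omega> \<in> A \<and> \<omega> \<in> D} = measure (chi_square a) A * prob D"
        by (simp add: measure_def enn2real_mult)
      moreover have "(\<integral>\<omega>\<in>D. indicat_real A (Q \<omega>) \<partial>M) = prob {\<omega> \<in> space M. Q \<omega> \<in> A \<and> \<omega> \<in> D}"
      proof -
        have "(\<integral>\<omega>\<in>D. indicat_real A (Q \<omega>) \<partial>M) = (\<integral>\<omega>. indicat_real {\<omega> \<in> space M. Q \<omega> \<in> A \<and> \<omega> \<in> D} \<omega> \<partial>M)"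
          unfolding set_lebesgue_integral_def by (intro Bochner_Integration.integral_cong) (auto simp: indicator_def)
        then show ?thesis by simp
      qed
      moreover have "(\<integral>\<omega>\<in>D. measure (chi_square a) A \<partial>M) = measure (chi_square a) A * prob D"
        by (simp add: set_lebesgue_integral_def)
      ultimately show "(\<integral>\<omega>\<in>D. indicat_real A (Q \<omega>) \<partial>M) = (\<integral>\<omega>\<in>D. measure (chi_square a) A \<partial>M)"
        by simp
    qed simp_all
  qed measurable

  show ?thesis
    using cond distV int E E' distU
    unfolding Q_def V_def U_def a_def b_def by blast
qed

end
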